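(* Let $\mathcal{E}:\mathbb{T}^2\to\mathbb{R}^3$ be an admissible embedding with associated toroidal domain $\Omega$, let $t\mapsto P_t$ be a differentiable family of smooth diffeomorphisms of $\mathbb{R}^3$ with $P_0=\mathrm{id}$, let $V=\frac{d}{dt}\big|_{t=0}P_t$, and let $\mathcal{E}_t=P_t\circ\mathcal{E}$, with $\varepsilon>0$ such that $\mathcal{E}_t$ is admissible for $|t|<\varepsilon$. Let $\Pi_t=\Pi(\mathcal{E}_t)$. Then the mapping $$(-\varepsilon,\varepsilon)\to\mathrm{Diff}(S^1),\qquad t\mapsto\Pi_t$$ is differentiable at $t=0$, and its derivative is given by $$\Pi'(\mathcal{E};V)(\theta)=\int_0^1\mathcal{T}(\phi,\theta)\,(X'_V)^\theta\big(\phi,\Pi^\phi(\theta)\big)\,d\phi,$$ where $$\mathcal{T}(\phi,\theta)=\exp\left(\int_\phi^1\partial_\theta X_0^\theta\big(\phi',\Pi^{\phi'}(\theta)\big)\,d\phi'\right),$$ $X_0=X(\mathcal{E})$, $\Pi^\phi=\Pi^\phi(\mathcal{E})$, and $X'_V=\frac{d}{dt}\big|_{t=0}(P_t^{-1})_*X(\mathcal{E}_t)\in\mathrm{Vec}(\partial\Omega)$.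
   Context: Notation: $S^1=\mathbb{R}/\mathbb{Z}$, $\mathbb{T}^2=\mathbb{R}^2/\mathbb{Z}^2$, $D^2$ is the closed unit disk of $\mathbb{R}^2$; $\mathrm{Vec}(M)$ is the space of smooth vector fields on $M$ with its $\mathcal{C}^\infty$ topology. Toroidal domains and harmonic fields: a smooth toroidal domain is an open set $\Omega\subset\mathbb{R}^3$ such that $\bar\Omega$ is smoothly diffeomorphic to $S^1\times D^2$. Its space of harmonic fields is $\mathcal{K}(\Omega)=\{u\in L^2(\Omega)^3: \mathrm{curl}\,u=0,\ \mathrm{div}\,u=0,\ u\cdot n=0\text{ on }\partial\Omega\}$, which is one-dimensional. Given a generator $\gamma$ of $H_1(\bar\Omega)\cong\mathbb{Z}$, $B(\Omega)$ is the unique element of $\mathcal{K}(\Omega)$ with $\int_\gamma B(\Omega)\cdot dl=1$; it is smooth up to the boundary. Admissible embeddings: let $\gamma_\phi,\gamma_\theta$ be the canonical generators of $H_1(\mathbb{T}^2)$. A smooth embedding $\mathcal{E}:\mathbb{T}^2\to\mathbb{R}^3$ is admissible if: (i) $\mathcal{E}(\mathbb{T}^2)$ bounds a smooth toroidal domain $\Omega$; (ii) $\mathcal{E}_*\gamma_\phi$ is trivial in $H_1(\Omega^c)$ and generates $H_1(\bar\Omega)$, while $\mathcal{E}_*\gamma_\theta$ is trivial in $H_1(\bar\Omega)$ and generates $H_1(\Omega^c)$, where $\Omega^c=\mathbb{R}^3\setminus\Omega$; (iii) if $B(\Omega)$ is the harmonic field normalized with the generator $\mathcal{E}_*\gamma_\phi$,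 and $(\phi,\theta)=\mathcal{E}^{-1}$ are the induced coordinates on $\partial\Omega$, then the $\phi$-component $B(\Omega)^\phi$ is positive everywhere on $\partial\Omega$. Poincaré map: for an admissible $\mathcal{E}$, let $X(\mathcal{E})=B(\Omega)/B(\Omega)^\phi\in\mathrm{Vec}(\partial\Omega)$, so that $X(\mathcal{E})=\partial_\phi+X(\mathcal{E})^\theta\partial_\theta$. Regard $X(\mathcal{E})^\theta$ as a function of $(\phi,\theta)\in\mathbb{T}^2$ and let $X_\phi(\mathcal{E})\in\mathrm{Vec}(S^1)$ be $X_\phi(\mathcal{E})(\theta)=X(\mathcal{E})^\theta(\phi,\theta)e_\theta$, with $e_\theta$ the canonical unit vector field of $S^1$. Let $\Pi^\phi(\mathcal{E})$ be the flow at time $\phi$, started at time $0$, of the non-autonomous vector field $\phi\mapsto X_\phi(\mathcal{E})$ (i.e. $\frac{d}{d\phi}\Pi^\phi(\theta)=X(\mathcal{E})^\theta(\phi,\Pi^\phi(\theta))$, $\Pi^0(\theta)=\theta$). The Poincaré map is $\Pi(\mathcal{E})=\Pi^1(\mathcal{E})\in\mathrm{Diff}(S^1)$. Other conventions: the family $P_t$ is differentiable for the $\mathcal{C}^\infty$ topology (uniform convergence of all derivatives on compact sets). For $|t|$ small $\mathcal{E}_t$ is admissible (its domain is $P_t(\Omega)$), and $t\mapsto(P_t^{-1})_*X(\mathcal{E}_t)\in\mathrm{Vec}(\partial\Omega)$ is differentiable at $0$, which defines $X'_V$; $(X'_V)^\theta$ and $X_0^\theta$ are $\theta$-components in the coordinates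 $(\phi,\theta)=\mathcal{E}^{-1}$. Differentiability at $0$ in $\mathrm{Diff}(S^1)$ means $\Pi_t=\Pi_0+t\,\Pi'(\mathcal{E};V)+o(t)$ with $\Pi'(\mathcal{E};V)\in\mathcal{C}^\infty(S^1)$ and $o(t)$ in every $\mathcal{C}^k$ norm (differences taken through continuous-in-$t$ lifts to $\mathbb{R}$). *)

theory Defs
  imports "HOL-Analysis.Analysis" "HOL-Homology.Homology"
begin

section \<open>Smooth maps and the smooth topology\<close>

fun iter_deriv :: "'a list \<Rightarrow> ('a::euclidean_space \<Rightarrow> 'b::euclidean_space) \<Rightarrow> 'a \<Rightarrow> 'b" where
  "iter_deriv [] f = f"
| "iter_deriv (v # vs) f = (\<lambda>x. frechet_derivative (iter_deriv vs f) (at x) v)"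

definition smooth_open :: "'a set \<Rightarrow> ('a::euclidean_space \<Rightarrow> 'b::euclidean_space) \<Rightarrow> bool" where
  "smooth_open U f \<longleftrightarrow> open U \<and>
     (\<forall>vs\<in>lists Basis. \<forall>x\<in>U. iter_deriv vs f differentiable (at x))"

abbreviation smooth :: "('a::euclidean_space \<Rightarrow> 'b::euclidean_space) \<Rightarrow> bool" where
  "smooth \<equiv> smooth_open UNIV"

text \<open>Smoothness on an arbitrary subset of a Euclidean space: local existence of smooth
  extensions. On the closure of a smooth domain this is smoothness up to the boundary.\<close>

definition smooth_on :: "'a set \<Rightarrow> ('a::euclidean_space \<Rightarrow> 'b::euclidean_space) \<Rightarrow> bool" where
  "smooth_on S f \<longleftrightarrow>
     (\<forall>x\<in>S. \<exists>U F. x \<in> U \<and> smooth_open U F \<and> (\<forall>y\<in>S \<inter> U. F y = f y))"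

definition diffeomorphic :: "'a::euclidean_space set \<Rightarrow> 'b::euclidean_space set \<Rightarrow> bool" where
  "diffeomorphic S T \<longleftrightarrow> (\<exists>f g. homeomorphism S T f g \<and> smooth_on S f \<and> smooth_on T g)"

definition diffeomorphism :: "('a::euclidean_space \<Rightarrow> 'a) \<Rightarrow> bool" where
  "diffeomorphism f \<longleftrightarrow> bij f \<and> smooth f \<and> smooth (inv_into UNIV f)"

text \<open>Derivative at \<open>t0\<close> of a curve of smooth maps, for the topology of uniform convergence of
  all partial derivatives on compact sets. For periodic maps, which are how maps on the circle
  and on the torus are represented below, this is convergence in every \<open>C\<^sup>k\<close> norm.\<close>

definition has_smooth_derivative ::
    "(real \<Rightarrow> 'a::euclidean_space \<Rightarrow> 'b::euclidean_space) \<Rightarrow> ('a \<Rightarrow> 'b) \<Rightarrow> real \<Rightarrow> bool" where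
  "has_smooth_derivative F F' t0 \<longleftrightarrow>
     (\<forall>\<^sub>F t in nhds t0. smooth (F t)) \<and> smooth F' \<and>
     (\<forall>vs\<in>lists Basis. \<forall>K. compact K \<longrightarrow>
        uniform_limit K
          (\<lambda>t x. (iter_deriv vs (F t) x - iter_deriv vs (F t0) x) /\<^sub>R (t - t0))
          (iter_deriv vs F') (at t0))"

definition pushforward ::
    "('a::euclidean_space \<Rightarrow> 'a) \<Rightarrow> ('a \<Rightarrow> 'a) \<Rightarrow> 'a \<Rightarrow> 'a" where
  "pushforward f Y = (\<lambda>y. frechet_derivative f (at (inv_into UNIV f y)) (Y (inv_into UNIV f y)))"


section \<open>Toroidal domains and harmonic fields\<close>

definition toroidal_domain :: "(real^3) set \<Rightarrow> bool" where
  "toroidal_domain \<Omega> \<longleftrightarrow> open \<Omega> \<and>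
     diffeomorphic (closure \<Omega>) (sphere (0::real^2) 1 \<times> cball (0::real^2) 1)"

definition grad :: "(real^3 \<Rightarrow> real) \<Rightarrow> real^3 \<Rightarrow> real^3" where
  "grad f x = (\<chi> i. frechet_derivative f (at x) (axis i 1))"

definition curl :: "(real^3 \<Rightarrow> real^3) \<Rightarrow> real^3 \<Rightarrow> real^3" where
  "curl F x = (let d = (\<lambda>i j. frechet_derivative F (at x) (axis i 1) $ j) in
     vector [d 2 3 - d 3 2, d 3 1 - d 1 3, d 1 2 - d 2 1])"

definition test_function :: "'a set \<Rightarrow> ('a::euclidean_space \<Rightarrow> 'b::euclidean_space) \<Rightarrow> bool" where
  "test_function U \<psi> \<longleftrightarrow> smooth \<psi> \<and> compact (closure {x. \<psi> x \<noteq> 0}) \<and> closure {x. \<psi> x \<noteq> 0} \<subseteq> U"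

text \<open>Curl and divergence vanish in the sense of distributions on \<open>\<Omega>\<close>. The last condition is
  the vanishing of the normal trace, defined through Green's formula: it maps \<open>\<psi>\<close> to the integral
  over \<open>\<Omega>\<close> of \<open>u \<bullet> grad \<psi> + \<psi> div u\<close>, and \<open>div u = 0\<close>.\<close>

definition harmonic_fields :: "(real^3) set \<Rightarrow> (real^3 \<Rightarrow> real^3) set" where
  "harmonic_fields \<Omega> = {u.
     set_borel_measurable lebesgue \<Omega> u \<and> set_integrable lebesgue \<Omega> (\<lambda>x. (norm (u x))\<^sup>2) \<and>
     (\<forall>\<Psi>::real^3 \<Rightarrow> real^3. test_function \<Omega> \<Psi> \<longrightarrow> (LINT x:\<Omega>|lebesgue. u x \<bullet> curl \<Psi> x) = 0) \<and>
     (\<forall>\<psi>::real^3 \<Rightarrow> real. test_function \<Omega> \<psi> \<longrightarrow> (LINT x:\<Omega>|lebesgue. u x \<bullet> grad \<psi> x) = 0) \<and>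
     (\<forall>\<psi>::real^3 \<Rightarrow> real. test_function UNIV \<psi> \<longrightarrow> (LINT x:\<Omega>|lebesgue. u x \<bullet> grad \<psi> x) = 0)}"

definition circulation :: "(real^3 \<Rightarrow> real^3) \<Rightarrow> (real \<Rightarrow> real^3) \<Rightarrow> real" where
  "circulation u \<gamma> = integral {0..1} (\<lambda>s. u (\<gamma> s) \<bullet> vector_derivative \<gamma> (at s))"

text \<open>Elements of \<open>L\<^sup>2\<close> are almost-everywhere classes; requiring smoothness up to the boundary
  selects the representative whose values on \<open>closure \<Omega>\<close> are meaningful. The value \<open>0\<close> off
  \<open>closure \<Omega>\<close> only makes the description unique.\<close>

definition harmonic_field :: "(real^3) set \<Rightarrow> (real \<Rightarrow> real^3) \<Rightarrow> real^3 \<Rightarrow> real^3" where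
  "harmonic_field \<Omega> \<gamma> = (THE u. u \<in> harmonic_fields \<Omega> \<and> smooth_on (closure \<Omega>) u \<and>
     circulation u \<gamma> = 1 \<and> (\<forall>x. x \<notin> closure \<Omega> \<longrightarrow> u x = 0))"


section \<open>Admissible embeddings of the torus\<close>

text \<open>Maps on the circle \<open>\<real>/\<int>\<close> and on the torus \<open>\<real>\<^sup>2/\<int>\<^sup>2\<close> are represented by their lifts to
  \<open>\<real>\<close> and \<open>\<real> \<times> \<real>\<close>; points of the torus are written \<open>(\<phi>, \<theta>)\<close>.\<close>

definition torus_embedding :: "(real \<times> real \<Rightarrow> real^3) \<Rightarrow> bool" where
  "torus_embedding E \<longleftrightarrow> smooth E \<and>
     (\<forall>p q. E p = E q \<longleftrightarrow> fst p - fst q \<in> \<int> \<and> snd p - snd q \<in> \<int>) \<and>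
     (\<forall>p. inj (frechet_derivative E (at p)))"

definition loop_phi :: "(real \<times> real \<Rightarrow> real^3) \<Rightarrow> real \<Rightarrow> real^3" where
  "loop_phi E s = E (s, 0)"

definition loop_theta :: "(real \<times> real \<Rightarrow> real^3) \<Rightarrow> real \<Rightarrow> real^3" where
  "loop_theta E s = E (0, s)"

text \<open>The class in first singular homology of a loop parametrised by \<open>[0,1]\<close>: the standard
  1-simplex is parametrised by its barycentric coordinate of index 1.\<close>

definition loop_class :: "'a topology \<Rightarrow> (real \<Rightarrow> 'a) \<Rightarrow> 'a chain set" where
  "loop_class X g =
     homologous_rel_set 1 X {} (frag_of (restrict (\<lambda>x. g (x 1)) (standard_simplex 1)))"

definition trivial_in_H1 :: "'a topology \<Rightarrow> (real \<Rightarrow> 'a) \<Rightarrow> bool" where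
  "trivial_in_H1 X g \<longleftrightarrow> loop_class X g = \<one>\<^bsub>homology_group 1 X\<^esub>"

definition generates_H1 :: "'a topology \<Rightarrow> (real \<Rightarrow> 'a) \<Rightarrow> bool" where
  "generates_H1 X g \<longleftrightarrow>
     generate (homology_group 1 X) {loop_class X g} = carrier (homology_group 1 X)"

definition bounded_domain :: "(real \<times> real \<Rightarrow> real^3) \<Rightarrow> (real^3) set" where
  "bounded_domain E = (THE \<Omega>. toroidal_domain \<Omega> \<and> frontier \<Omega> = range E)"

definition harmonic_of :: "(real \<times> real \<Rightarrow> real^3) \<Rightarrow> real^3 \<Rightarrow> real^3" where
  "harmonic_of E = harmonic_field (bounded_domain E) (loop_phi E)"

text \<open>For a vector field \<open>Y\<close> tangent to the surface \<open>range E\<close>, the pair of coordinate functions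
  \<open>(Y\<^sup>\<phi>, Y\<^sup>\<theta>)\<close> on the torus, determined by
  \<open>Y (E p) = Y\<^sup>\<phi> p \<partial>\<^sub>\<phi>E p + Y\<^sup>\<theta> p \<partial>\<^sub>\<theta>E p\<close>.\<close>

definition components ::
    "(real \<times> real \<Rightarrow> real^3) \<Rightarrow> (real^3 \<Rightarrow> real^3) \<Rightarrow> real \<times> real \<Rightarrow> real \<times> real" where
  "components E Y p = (THE c. frechet_derivative E (at p) c = Y (E p))"

abbreviation phi_component ::
    "(real \<times> real \<Rightarrow> real^3) \<Rightarrow> (real^3 \<Rightarrow> real^3) \<Rightarrow> real \<times> real \<Rightarrow> real" where
  "phi_component E Y p \<equiv> fst (components E Y p)"

abbreviation theta_component ::
    "(real \<times> real \<Rightarrow> real^3) \<Rightarrow> (real^3 \<Rightarrow> real^3) \<Rightarrow> real \<times> real \<Rightarrow> real" where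
  "theta_component E Y p \<equiv> snd (components E Y p)"

definition admissible :: "(real \<times> real \<Rightarrow> real^3) \<Rightarrow> bool" where
  "admissible E \<longleftrightarrow> torus_embedding E \<and>
     (\<exists>\<Omega>. toroidal_domain \<Omega> \<and> frontier \<Omega> = range E) \<and>
     trivial_in_H1 (top_of_set (- bounded_domain E)) (loop_phi E) \<and>
     generates_H1 (top_of_set (closure (bounded_domain E))) (loop_phi E) \<and>
     trivial_in_H1 (top_of_set (closure (bounded_domain E))) (loop_theta E) \<and>
     generates_H1 (top_of_set (- bounded_domain E)) (loop_theta E) \<and>
     (\<forall>p. phi_component E (harmonic_of E) p > 0)"


section \<open>Vector fields on the boundary\<close>

text \<open>The smooth vector fields on the surface \<open>range E = frontier (bounded_domain E)\<close>, with the smooth topology read in the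
  global coordinates \<open>(\<phi>, \<theta>)\<close> given by the inverse of \<open>E\<close>. Vector fields are functions on the
  ambient space, of which only the values on the surface matter.\<close>

definition Vec :: "(real \<times> real \<Rightarrow> real^3) \<Rightarrow> (real^3 \<Rightarrow> real^3) set" where
  "Vec E = {Y. (\<forall>p. Y (E p) \<in> range (frechet_derivative E (at p))) \<and> smooth (components E Y)}"

definition Vec_has_derivative_at_0 ::
    "(real \<times> real \<Rightarrow> real^3) \<Rightarrow> real \<Rightarrow> (real \<Rightarrow> real^3 \<Rightarrow> real^3) \<Rightarrow> (real^3 \<Rightarrow> real^3) \<Rightarrow> bool" where
  "Vec_has_derivative_at_0 E \<epsilon> Y Y' \<longleftrightarrow>
     (\<forall>t. \<bar>t\<bar> < \<epsilon> \<longrightarrow> Y t \<in> Vec E) \<and> Y' \<in> Vec E \<and>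
     has_smooth_derivative (\<lambda>t. components E (Y t)) (components E Y') 0"


section \<open>The Poincare map\<close>

definition X_field :: "(real \<times> real \<Rightarrow> real^3) \<Rightarrow> real^3 \<Rightarrow> real^3" where
  "X_field E x = harmonic_of E x /\<^sub>R phi_component E (harmonic_of E) (SOME p. E p = x)"

definition is_flow :: "(real \<times> real \<Rightarrow> real) \<Rightarrow> (real \<Rightarrow> real \<Rightarrow> real) \<Rightarrow> bool" where
  "is_flow a \<Phi> \<longleftrightarrow> (\<forall>\<theta>. \<Phi> 0 \<theta> = \<theta> \<and>
     (\<forall>\<phi>. ((\<lambda>s. \<Phi> s \<theta>) has_real_derivative a (\<phi>, \<Phi> \<phi> \<theta>)) (at \<phi>)))"

text \<open>The flow on the circle is represented by its lift to \<open>\<real>\<close> starting at the identity.\<close>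

definition flow :: "(real \<times> real \<Rightarrow> real^3) \<Rightarrow> real \<Rightarrow> real \<Rightarrow> real" where
  "flow E = (THE \<Phi>. is_flow (theta_component E (X_field E)) \<Phi>)"

definition Poincare_map :: "(real \<times> real \<Rightarrow> real^3) \<Rightarrow> real \<Rightarrow> real" where
  "Poincare_map E = flow E 1"

definition circle_diffeo :: "(real \<Rightarrow> real) \<Rightarrow> bool" where
  "circle_diffeo f \<longleftrightarrow> diffeomorphism f \<and>
     ((\<forall>\<theta>. f (\<theta> + 1) = f \<theta> + 1) \<or> (\<forall>\<theta>. f (\<theta> + 1) = f \<theta> - 1))"

text \<open>Differentiability at \<open>0\<close> of a curve in the group of diffeomorphisms of the circle, given by
  lifts; the lifts depend continuously on \<open>t\<close> at \<open>0\<close> because the difference quotients converge.\<close>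

definition Diff_circle_has_derivative_at_0 ::
    "real \<Rightarrow> (real \<Rightarrow> real \<Rightarrow> real) \<Rightarrow> (real \<Rightarrow> real) \<Rightarrow> bool" where
  "Diff_circle_has_derivative_at_0 \<epsilon> f f' \<longleftrightarrow>
     (\<forall>t. \<bar>t\<bar> < \<epsilon> \<longrightarrow> circle_diffeo (f t)) \<and> (\<forall>\<theta>. f' (\<theta> + 1) = f' \<theta>) \<and>
     has_smooth_derivative f f' 0"

end

(* In the coordinates given by E, the field X(E_t) becomes a curve G t of smooth doubly periodic
   fields on the plane, which is differentiable at t = 0 by hypothesis; harmonic fields play no
   further role. Write b_t for the theta-component, b_t = b_0 + t beta_t, and let Phi_t be its flow.
   By Hadamard's lemma W = Phi_t - Phi_0 solves the linear equation
     W' = h W + t beta_t(Phi_t),  h = int_0^1 (d b_0)(Phi_0 + u (Phi_t - Phi_0)) du,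
   so variation of constants gives Phi_t - Phi_0 = t Q_t with Q_t explicit, and Q_0 is the stated
   derivative. It remains to see that all theta-derivatives of Q_t depend continuously on t at 0.
   Nothing is known about continuity in t away from 0, so t is restricted to the compact sets
   T consisting of 0 and the terms of a sequence tending to 0, on which beta is jointly continuous. *)

theory Submission
  imports Defs
begin

text \<open>No difference quotient in \<open>t\<close> is available away from 0, so all regularity
  is recorded by one class that never differentiates in its parameter. A parameter is usually a
  pair: first the member of the family, then time. The class is stable under composition,
  integration over a parameter and Hadamard quotients (at the price of one derivative of the field).
  Once the flow is known to be continuous, explicit formulas therefore carry the regularity to its
  derivatives and to the quotient in \<open>t\<close>, without further estimates. The linear
  equation for the difference of two trajectories serves three times: same field and same starting
  point give uniqueness; same field and different starting points give the derivative in \<theta>;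
  different fields and the same starting point give the quotient in \<open>t\<close>. Periodicity in
  both variables together with compactness of \<open>T\<close> provides global bounds and Lipschitz
  constants, so trajectories exist for all times. Each sequence tending to 0 brings its own
  \<open>T\<close>; uniqueness of the flow makes the results for different \<open>T\<close>
  agree.\<close>

text \<open>\<open>fibre_C k S f\<close>: on the fibres \<open>{p} \<times> \<real>\<close> the function is \<open>k\<close> times differentiable, with derivatives
  jointly continuous in the parameter and the variable. No differentiability in the parameter
  is asked for.\<close>

fun fibre_C :: "nat \<Rightarrow> 'p::topological_space set \<Rightarrow> ('p \<Rightarrow> real \<Rightarrow> real) \<Rightarrow> bool" where
  "fibre_C 0 S f \<longleftrightarrow> continuous_on (S \<times> UNIV) (\<lambda>z. f (fst z) (snd z))"
| "fibre_C (Suc k) S f \<longleftrightarrow> continuous_on (S \<times> UNIV) (\<lambda>z. f (fst z) (snd z)) \<and>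
     (\<forall>p\<in>S. \<forall>x. f p field_differentiable at x) \<and> fibre_C k S (\<lambda>p. deriv (f p))"

section \<open>Closure properties of fibrewise C^k families\<close>

lemma fibre_C_continuous:
  "fibre_C k S f \<Longrightarrow> continuous_on (S \<times> UNIV) (\<lambda>z. f (fst z) (snd z))"
  by (cases k) auto

lemma fibre_C_cong:
  "(\<And>p. p \<in> S \<Longrightarrow> f p = g p) \<Longrightarrow> fibre_C k S f \<longleftrightarrow> fibre_C k S g"
proof (induction k arbitrary: f g)
  case 0
  have "continuous_on (S \<times> UNIV) (\<lambda>z. f (fst z) (snd z)) \<longleftrightarrow>
    continuous_on (S \<times> UNIV) (\<lambda>z. g (fst z) (snd z))"
    by (rule continuous_on_cong) (auto simp: 0)
  then show ?case by simp
next
  case (Suc k)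
  have "continuous_on (S \<times> UNIV) (\<lambda>z. f (fst z) (snd z)) \<longleftrightarrow>
    continuous_on (S \<times> UNIV) (\<lambda>z. g (fst z) (snd z))"
    by (rule continuous_on_cong) (auto simp: Suc.prems)
  moreover have "fibre_C k S (\<lambda>p. deriv (f p)) \<longleftrightarrow> fibre_C k S (\<lambda>p. deriv (g p))"
    by (rule Suc.IH) (simp add: Suc.prems)
  ultimately show ?case by (simp add: Suc.prems)
qed

lemma fibre_C_SucD: "fibre_C (Suc k) S f \<Longrightarrow> fibre_C k S f"
  by (induction k arbitrary: f) auto

text \<open>Lets an explicit formula \<open>g\<close> stand in for \<open>deriv\<close>, so that the
  induction hypothesis on \<open>k\<close> can be applied to that formula.\<close>

lemma fibre_C_SucI:
  assumes "continuous_on (S \<times> UNIV) (\<lambda>z. f (fst z) (snd z))"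
    and "\<And>p x. p \<in> S \<Longrightarrow> (f p has_real_derivative g p x) (at x)"
    and "fibre_C k S g"
  shows "fibre_C (Suc k) S f"
proof -
  have "fibre_C k S (\<lambda>p. deriv (f p)) \<longleftrightarrow> fibre_C k S g"
    by (rule fibre_C_cong) (use assms(2) in \<open>auto intro!: DERIV_imp_deriv\<close>)
  then show ?thesis
    using assms by (auto simp: field_differentiable_def)
qed

lemma fibre_C_deriv:
  assumes "fibre_C (Suc k) S f" "p \<in> S"
  shows "(f p has_real_derivative deriv (f p) x) (at x)"
  using assms by (simp add: DERIV_deriv_iff_field_differentiable)

lemma fibre_C_param:
  assumes "continuous_on S h"
  shows "fibre_C k S (\<lambda>p x. h p)"
  using assms
proof (induction k arbitrary: h)
  case 0
  then show ?case
    by (auto intro!: continuous_on_compose2[OF 0] continuous_intros)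
next
  case (Suc k)
  show ?case
    by (rule fibre_C_SucI[where g = "\<lambda>_ _. 0"])
      (auto intro!: continuous_on_compose2[OF Suc.prems] continuous_intros Suc.IH)
qed

lemma fibre_C_id: "fibre_C k S (\<lambda>p x. x)"
proof (cases k)
  case 0
  then show ?thesis by (auto intro!: continuous_intros)
next
  case (Suc n)
  show ?thesis unfolding Suc
    by (rule fibre_C_SucI[where g = "\<lambda>_ _. 1"])
      (auto intro!: continuous_intros fibre_C_param)
qed

lemma fibre_C_add:
  assumes "fibre_C k S f" "fibre_C k S g"
  shows "fibre_C k S (\<lambda>p x. f p x + g p x)"
  using assms
proof (induction k arbitrary: f g)
  case 0
  then show ?case by (auto intro!: continuous_intros)
next
  case (Suc k)
  show ?case
    by (rule fibre_C_SucI[where g = "\<lambda>p x. deriv (f p) x + deriv (g p) x"])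
      (use Suc in \<open>auto intro!: continuous_intros derivative_intros 
         fibre_C_deriv[OF Suc.prems(1)] fibre_C_deriv[OF Suc.prems(2)]\<close>)
qed

lemma fibre_C_mult:
  assumes "fibre_C k S f" "fibre_C k S g"
  shows "fibre_C k S (\<lambda>p x. f p x * g p x)"
  using assms
proof (induction k arbitrary: f g)
  case 0
  then show ?case by (auto intro!: continuous_intros)
next
  case (Suc k)
  show ?case
  proof (rule fibre_C_SucI[where g = "\<lambda>p x. deriv (f p) x * g p x + deriv (g p) x * f p x"])
    show "continuous_on (S \<times> UNIV) (\<lambda>z. f (fst z) (snd z) * g (fst z) (snd z))"
      using Suc.prems by (auto intro!: continuous_intros)
    show "((\<lambda>x. f p x * g p x) has_real_derivative deriv (f p) x * g p x + deriv (g p) x * f p x)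
        (at x)" if "p \<in> S" for p x
      using DERIV_mult[OF fibre_C_deriv[OF Suc.prems(1) that] fibre_C_deriv[OF Suc.prems(2) that]] .
    show "fibre_C k S (\<lambda>p x. deriv (f p) x * g p x + deriv (g p) x * f p x)"
      using Suc.prems fibre_C_SucD[OF Suc.prems(1)] fibre_C_SucD[OF Suc.prems(2)]
      by (intro fibre_C_add Suc.IH) simp_all
  qed
qed

lemma fibre_C_diff:
  assumes "fibre_C k S f" "fibre_C k S g"
  shows "fibre_C k S (\<lambda>p x. f p x - g p x)"
  using fibre_C_add[OF assms(1) fibre_C_mult[OF fibre_C_param[of S "\<lambda>_. -1"] assms(2)]] by simp

lemma fibre_C_minus: "fibre_C k S f \<Longrightarrow> fibre_C k S (\<lambda>p x. - f p x)"
  using fibre_C_mult[OF fibre_C_param[of S "\<lambda>_. -1"], of k f] by simp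

lemma continuous_fibre_comp:
  assumes "continuous_on (S \<times> UNIV) (\<lambda>z. f (fst z) (snd z))"
    and "continuous_on (S' \<times> UNIV) (\<lambda>z. g (fst z) (snd z))"
    and "continuous_on S' h" "h ` S' \<subseteq> S"
  shows "continuous_on (S' \<times> UNIV) (\<lambda>z. f (h (fst z)) (g (fst z) (snd z)))"
proof -
  have "continuous_on (S' \<times> UNIV) (\<lambda>z. (h (fst z), g (fst z) (snd z)))"
    by (intro continuous_on_Pair assms(2) continuous_on_compose2[OF assms(3)] continuous_intros) auto
  from continuous_on_compose2[OF assms(1) this] show ?thesis
    using assms(4) by (simp add: image_subset_iff)
qed

text \<open>In the chain rule the inner function stays \<open>g\<close> while the outer one becomes
  its derivative; hence the induction generalises over \<open>f\<close> only.\<close>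

lemma fibre_C_comp:
  assumes "fibre_C k S f" "fibre_C k S g"
  shows "fibre_C k S (\<lambda>p x. f p (g p x))"
  using assms
proof (induction k arbitrary: f)
  case 0
  then show ?case
    using continuous_fibre_comp[of S f S g "\<lambda>p. p"] by simp
next
  case (Suc k)
  have c: "continuous_on (S \<times> UNIV) (\<lambda>z. f (fst z) (snd z))"
    "continuous_on (S \<times> UNIV) (\<lambda>z. g (fst z) (snd z))"
    using Suc.prems by auto
  show ?case
  proof (rule fibre_C_SucI[where g = "\<lambda>p x. deriv (f p) (g p x) * deriv (g p) x"])
    show "continuous_on (S \<times> UNIV) (\<lambda>z. f (fst z) (g (fst z) (snd z)))"
      using continuous_fibre_comp[of S f S g "\<lambda>p. p"] c by simp
    show "((\<lambda>x. f p (g p x)) has_real_derivative deriv (f p) (g p x) * deriv (g p) x) (at x)"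
      if "p \<in> S" for p x
      using DERIV_chain2[OF fibre_C_deriv[OF Suc.prems(1) that] fibre_C_deriv[OF Suc.prems(2) that]] .
    show "fibre_C k S (\<lambda>p x. deriv (f p) (g p x) * deriv (g p) x)"
      using fibre_C_mult[OF Suc.IH[of "\<lambda>p. deriv (f p)"], of "\<lambda>p. deriv (g p)"]
        Suc.prems fibre_C_SucD[OF Suc.prems(2)] by simp
  qed
qed

lemma fibre_C_reparam:
  assumes "fibre_C k S f" "continuous_on S' h" "h ` S' \<subseteq> S"
  shows "fibre_C k S' (\<lambda>p. f (h p))"
  using assms(1)
proof (induction k arbitrary: f)
  case 0
  then show ?case
    using continuous_fibre_comp[of S f S' "\<lambda>_ x. x" h] assms(2,3)
    by (simp add: continuous_on_snd)
next
  case (Suc k)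
  have "fibre_C 0 S' (\<lambda>p. f (h p))"
    using Suc.prems continuous_fibre_comp[of S f S' "\<lambda>_ x. x" h] assms(2,3)
    by (simp add: continuous_on_snd)
  then show ?case
    using Suc assms(3) by (auto simp: image_subset_iff)
qed

lemma fibre_C_exp: 
  assumes "fibre_C k S f"
  shows "fibre_C k S (\<lambda>p x. exp (f p x))"
proof -
  have "fibre_C k S (\<lambda>p x. exp x)"
  proof (induction k)
    case 0
    then show ?case by (auto intro!: continuous_intros)
  next
    case (Suc k)
    show ?case
      by (rule fibre_C_SucI[where g = "\<lambda>_. exp"])
        (auto intro!: continuous_intros Suc)
  qed
  then show ?thesis using assms by (rule fibre_C_comp)
qed

text \<open>The integration variable is one more parameter of the integrand. Joint continuity on the
  compact fibre \<open>{0..1}\<close> justifies differentiating under the integral sign.\<close>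

lemma fibre_C_integral:
  assumes "fibre_C k (S \<times> {0..1::real}) g"
  shows "fibre_C k S (\<lambda>p x. integral {0..1} (\<lambda>u. g (p, u) x))"
  using assms
proof (induction k arbitrary: g)
  case 0
  then have c: "continuous_on ((S \<times> UNIV) \<times> cbox 0 1) (\<lambda>(z,u). g (fst z, u) (snd z))"
    unfolding split_beta
    by (auto intro!: continuous_on_compose2[where g = "\<lambda>z. g (fst z) (snd z)" and 
        f = "\<lambda>z. ((fst (fst z), snd z), snd (fst z))", simplified] continuous_intros)
  from integral_continuous_on_param[OF c] show ?case by simp
next
  case (Suc k)
  have *: "continuous_on ((S \<times> UNIV) \<times> cbox 0 1) (\<lambda>(z,u). g (fst z, u) (snd z))"
    if "fibre_C n (S \<times> {0..1::real}) g" for n g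
    using fibre_C_continuous[OF that] unfolding split_beta
    by (auto intro!: continuous_on_compose2[where g = "\<lambda>z. g (fst z) (snd z)" and 
        f = "\<lambda>z. ((fst (fst z), snd z), snd (fst z))", simplified] continuous_intros)
  have d: "fibre_C k (S \<times> {0..1}) (\<lambda>p. deriv (g p))"
    using Suc.prems by simp
  show ?case
  proof (rule fibre_C_SucI[where g = "\<lambda>p x. integral {0..1} (\<lambda>u. deriv (g (p, u)) x)"])
    show "continuous_on (S \<times> UNIV) (\<lambda>z. integral {0..1} (\<lambda>u. g (fst z, u) (snd z)))"
      using integral_continuous_on_param[OF *[OF Suc.prems]] by simp
    show "((\<lambda>x. integral {0..1} (\<lambda>u. g (p, u) x)) has_real_derivative
         integral {0..1} (\<lambda>u. deriv (g (p, u)) x)) (at x)" if p: "p \<in> S" for p x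
    proof -
      have "((\<lambda>x. integral (cbox 0 1) (\<lambda>u. g (p, u) x)) has_real_derivative
         integral (cbox 0 1) (\<lambda>u. deriv (g (p, u)) x)) (at x within UNIV)"
      proof (rule leibniz_rule_field_derivative)
        show "((\<lambda>x. g (p, u) x) has_field_derivative deriv (g (p, u)) x) (at x within UNIV)"
          if "u \<in> cbox 0 1" for x u
          using fibre_C_deriv[OF Suc.prems, of "(p, u)"] p that by simp
        have "continuous_on (cbox 0 1) (\<lambda>u. g (p, u) x)" for x
          using p by (auto intro!: continuous_on_compose2[OF *[OF Suc.prems], 
            where f = "\<lambda>u. ((p, x), u)", simplified] continuous_intros)
        then show "(\<lambda>u. g (p, u) x) integrable_on cbox 0 1" for x
          by (rule integrable_continuous)
        show "continuous_on (UNIV \<times> cbox 0 1) (\<lambda>(x, u). deriv (g (p, u)) x)"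
          unfolding split_beta
          using p by (auto intro!: continuous_on_compose2[OF *[OF d], 
            where f = "\<lambda>z. ((p, fst z), snd z)", simplified] continuous_intros)
      qed auto
      then show ?thesis by simp
    qed
    show "fibre_C k S (\<lambda>p x. integral {0..1} (\<lambda>u. deriv (g (p, u)) x))"
      by (rule Suc.IH[OF d])
  qed
qed

section \<open>Primitives, Hadamard quotients and scalar linear equations\<close>

text \<open>The integral of \<open>h\<close> from \<open>0\<close> to \<open>t\<close>, rescaled to the fixed interval \<open>{0..1}\<close> so that negative \<open>t\<close> is covered
  and dependence on \<open>t\<close> is dependence of the integrand on a parameter.\<close>

definition prim :: "(real \<Rightarrow> real) \<Rightarrow> real \<Rightarrow> real" where
  "prim h t = t * integral {0..1} (\<lambda>u. h (t * u))"

text \<open>For differentiable \<open>f\<close> this is the difference quotient of \<open>f\<close>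
  between \<open>x\<close> and \<open>y\<close>, extended by \<open>deriv f x\<close> to the
  diagonal. Written as an average of the derivative, it depends regularly on both endpoints, even
  where they meet.\<close>

definition hadamard :: "(real \<Rightarrow> real) \<Rightarrow> real \<Rightarrow> real \<Rightarrow> real" where
  "hadamard f x y = integral {0..1} (\<lambda>u. deriv f (x + u * (y - x)))"

lemma prim_unique:
  assumes "\<And>s. (H has_real_derivative h s) (at s)"
  shows "prim h t = H t - H 0"
proof -
  have "((\<lambda>u. H (t * u)) has_real_derivative h (t * u) * t) (at u within {0..1})" for u
    by (rule DERIV_chain2[OF assms]) (auto intro!: derivative_eq_intros)
  then have "((\<lambda>u. h (t * u) * t) has_integral H (t * 1) - H (t * 0)) {0..1}"
    by (intro fundamental_theorem_of_calculus)
      (auto simp: has_real_derivative_iff_has_vector_derivative)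
  from integral_unique[OF this] show ?thesis
    by (simp add: prim_def mult.commute)
qed

lemma continuous_antiderivative:
  fixes h :: "real \<Rightarrow> real"
  assumes "continuous_on UNIV h"
  obtains H where "\<And>s. (H has_real_derivative h s) (at s)"
proof -
  have "\<And>x. isCont h x"
    using assms by (simp add: continuous_on_eq_continuous_at)
  with einterval_antiderivative[of "-\<infinity>" "\<infinity>" h] show ?thesis
    using that by (auto simp: has_real_derivative_iff_has_vector_derivative)
qed

text \<open>A global antiderivative \<open>H\<close> exists by continuity, and \<open>prim h\<close>
  differs from it by a constant; this treats positive and negative times alike.\<close>

lemma prim_has_derivative:
  assumes "continuous_on UNIV h"
  shows "(prim h has_real_derivative h t) (at t)"
proof -
  obtain H where H: "\<And>s. (H has_real_derivative h s) (at s)"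
    using continuous_antiderivative[OF assms] by blast
  then have "prim h = (\<lambda>t. H t - H 0)"
    by (auto simp: prim_unique)
  then show ?thesis
    using DERIV_diff[OF H DERIV_const] by simp
qed

lemma prim_0 [simp]: "prim h 0 = 0"
  by (simp add: prim_def)

lemma prim_eq_integral:
  assumes "continuous_on UNIV h" "a \<le> b"
  shows "prim h b - prim h a = integral {a..b} h"
proof -
  have "(h has_integral prim h b - prim h a) {a..b}"
    using assms prim_has_derivative[OF assms(1)]
    by (intro fundamental_theorem_of_calculus)
      (auto simp: has_real_derivative_iff_has_vector_derivative[symmetric] intro: DERIV_subset)
  then show ?thesis by (simp add: integral_unique)
qed

lemma prim_cmult: "prim (\<lambda>s. c * h s) t = c * prim h t"
  by (simp add: prim_def integral_mult_right)

lemma prim_diff: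
  assumes "continuous_on UNIV g" "continuous_on UNIV h"
  shows "prim g t - prim h t = prim (\<lambda>s. g s - h s) t"
proof -
  have "(\<lambda>u. g (t * u)) integrable_on {0..1}" "(\<lambda>u. h (t * u)) integrable_on {0..1}"
    by (auto intro!: integrable_continuous_interval continuous_on_compose2[OF assms(1)]
      continuous_on_compose2[OF assms(2)] continuous_intros)
  then show ?thesis
    by (simp add: prim_def integral_diff right_diff_distrib)
qed

text \<open>Each integration of a power bound gains a factor \<open>1 / Suc n\<close>; iterated,
  these factors build the factorial in the Picard estimate.\<close>

lemma prim_bound:
  assumes "continuous_on UNIV h" "\<And>s. \<bar>h s\<bar> \<le> C * \<bar>s\<bar> ^ n"
  shows "\<bar>prim h t\<bar> \<le> C * \<bar>t\<bar> ^ Suc n / Suc n"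
proof -
  have i: "((\<lambda>u. C * \<bar>t\<bar> ^ n * u ^ n) has_integral
     C * \<bar>t\<bar> ^ n * 1 ^ Suc n / Suc n - C * \<bar>t\<bar> ^ n * 0 ^ Suc n / Suc n) {0..1::real}"
    by (intro fundamental_theorem_of_calculus)
      (auto simp: has_real_derivative_iff_has_vector_derivative[symmetric] simp del: power_Suc
        intro!: derivative_eq_intros)
  have "norm (integral {0..1} (\<lambda>u. h (t * u))) \<le> integral {0..1} (\<lambda>u. C * \<bar>t\<bar> ^ n * u ^ n)"
  proof (rule Henstock_Kurzweil_Integration.integral_norm_bound_integral)
    show "(\<lambda>u. h (t * u)) integrable_on {0..1}"
      by (auto intro!: integrable_continuous_interval continuous_on_compose2[OF assms(1)] continuous_intros)
    show "(\<lambda>u. C * \<bar>t\<bar> ^ n * u ^ n) integrable_on {0..1}"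
      using i by blast
    show "norm (h (t * u)) \<le> C * \<bar>t\<bar> ^ n * u ^ n" if "u \<in> {0..1}" for u
      using assms(2)[of "t * u"] that by (simp add: abs_mult power_mult_distrib mult.assoc)
  qed
  also have "\<dots> = C * \<bar>t\<bar> ^ n / Suc n"
    using integral_unique[OF i] by simp
  finally have "\<bar>t\<bar> * norm (integral {0..1} (\<lambda>u. h (t * u))) \<le> \<bar>t\<bar> * (C * \<bar>t\<bar> ^ n / Suc n)"
    by (intro mult_left_mono) auto
  then show ?thesis
    by (simp add: prim_def abs_mult algebra_simps)
qed

text \<open>Variation of constants: after multiplication by the integrating factor
  \<open>exp (- prim c s)\<close>, the difference between \<open>y\<close> and the inhomogeneous
  term has derivative zero.\<close>

lemma linear_ode:
  fixes y :: "real \<Rightarrow> real"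
  assumes c: "continuous_on UNIV c" and d: "continuous_on UNIV d"
    and y: "\<And>s. (y has_real_derivative c s * y s + d s) (at s)"
  shows "y t = exp (prim c t) * (y 0 + prim (\<lambda>s. exp (- prim c s) * d s) t)"
proof -
  note C = prim_has_derivative[OF c]
  have "continuous_on UNIV (prim c)"
    using C by (meson DERIV_isCont continuous_at_imp_continuous_on)
  then have D: "(prim (\<lambda>s. exp (- prim c s) * d s) has_real_derivative exp (- prim c s) * d s) (at s)" for s
    by (intro prim_has_derivative continuous_intros d)
  have "((\<lambda>s. exp (- prim c s) * y s - prim (\<lambda>s. exp (- prim c s) * d s) s)
      has_real_derivative 0) (at s)" for s
    by (rule derivative_eq_intros C D y refl)+ (simp add: algebra_simps)
  then have "exp (- prim c t) * y t - prim (\<lambda>s. exp (- prim c s) * d s) t =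
    exp (- prim c 0) * y 0 - prim (\<lambda>s. exp (- prim c s) * d s) 0"
    by (intro DERIV_isconst_all allI)
  then have "exp (- prim c t) * y t = y 0 + prim (\<lambda>s. exp (- prim c s) * d s) t"
    by simp
  then show ?thesis
    by (metis exp_minus_inverse mult.assoc mult_1)
qed

lemma hadamard_same [simp]: "hadamard f x x = deriv f x"
  by (simp add: hadamard_def)

lemma hadamard_eq:
  assumes "\<And>z. (f has_real_derivative deriv f z) (at z)"
  shows "f y - f x = hadamard f x y * (y - x)"
proof -
  have "((\<lambda>u. f (x + u * (y - x))) has_real_derivative
      deriv f (x + u * (y - x)) * (y - x)) (at u within {0..1})" for u
    by (rule DERIV_chain2[OF assms]) (auto intro!: derivative_eq_intros)
  then have "((\<lambda>u. deriv f (x + u * (y - x)) * (y - x)) has_integral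
      f (x + 1 * (y - x)) - f (x + 0 * (y - x))) {0..1}"
    by (intro fundamental_theorem_of_calculus)
      (auto simp: has_real_derivative_iff_has_vector_derivative)
  from integral_unique[OF this] show ?thesis
    by (simp add: hadamard_def)
qed

text \<open>One order of \<open>f\<close> is spent on \<open>deriv f\<close>; the endpoints enter
  only through composition and keep their order.\<close>

lemma fibre_C_hadamard:
  assumes "fibre_C (Suc k) S f" "fibre_C k S g" "fibre_C k S h"
  shows "fibre_C k S (\<lambda>p x. hadamard (f p) (g p x) (h p x))"
proof -
  have r: "fibre_C k (S \<times> {0..1::real}) (\<lambda>q. e (fst q))" if "fibre_C k S e" for e
    by (rule fibre_C_reparam[OF that]) (auto intro!: continuous_intros)
  have "fibre_C k S (\<lambda>p. deriv (f p))"
    using assms(1) by simp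
  note f = r[OF this]
  have "fibre_C k (S \<times> {0..1::real}) (\<lambda>q x. g (fst q) x + snd q * (h (fst q) x - g (fst q) x))"
    by (intro fibre_C_add fibre_C_mult fibre_C_diff r assms fibre_C_param continuous_intros)
  note fibre_C_comp[OF f this]
  from fibre_C_integral[OF this] show ?thesis
    by (simp add: hadamard_def)
qed

text \<open>After rescaling, the time \<open>snd p\<close> appears only as a factor and in the
  reparametrisation \<open>(t, s * u)\<close>, so the rule for integrals over \<open>{0..1}\<close>
  applies.\<close>

lemma fibre_C_prim:
  assumes "fibre_C k (T \<times> UNIV) f"
  shows "fibre_C k (T \<times> UNIV) (\<lambda>p x. prim (\<lambda>s. f (fst p, s) x) (snd p))"
proof -
  have "fibre_C k ((T \<times> UNIV) \<times> {0..1::real}) (\<lambda>q. f (fst (fst q), snd (fst q) * snd q))"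
    by (rule fibre_C_reparam[OF assms]) (auto intro!: continuous_intros)
  from fibre_C_mult[OF fibre_C_param fibre_C_integral[OF this], of snd] show ?thesis
    by (simp add: prim_def continuous_on_snd)
qed

lemma fibre_C_time_continuous:
  assumes "fibre_C k (T \<times> UNIV) f" "t \<in> T" "continuous_on UNIV x"
  shows "continuous_on UNIV (\<lambda>s. f (t, s) (x s))"
proof -
  have "continuous_on UNIV (\<lambda>s. ((t, s), x s))"
    by (intro continuous_intros assms)
  from continuous_on_compose2[OF fibre_C_continuous[OF assms(1)] this] show ?thesis
    using assms(2) by auto
qed

section \<open>Existence of global flows by Picard iteration\<close>

primrec picard :: "('q \<times> real \<Rightarrow> real \<Rightarrow> real) \<Rightarrow> nat \<Rightarrow> 'q \<times> real \<Rightarrow> real \<Rightarrow> real" where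
  "picard b 0 = (\<lambda>p x. x)"
| "picard b (Suc n) = (\<lambda>p x. x + prim (\<lambda>s. b (fst p, s) (picard b n (fst p, s) x)) (snd p))"

lemma fibre_C_picard: 
  assumes "fibre_C 0 (T \<times> UNIV) b"
  shows "fibre_C 0 (T \<times> UNIV) (picard b n)"
proof (induction n)
  case 0
  show ?case using fibre_C_id[of 0 "T \<times> UNIV"] unfolding picard.simps .
next
  case (Suc n)
  have "fibre_C 0 (T \<times> UNIV) (\<lambda>p x. b p (picard b n p x))"
    by (rule fibre_C_comp[OF assms Suc])
  from fibre_C_add[OF fibre_C_id fibre_C_prim[OF this]] show ?case
    by simp
qed

text \<open>The Lipschitz bound turns the estimate for one step into an integrand for the next, and
  integrating the power of \<open>s\<close> supplies the new factor of the factorial.\<close>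

lemma picard_step:
  assumes b: "fibre_C 0 (T \<times> UNIV) b" and t: "t \<in> T"
    and bound: "\<And>s x. \<bar>b (t, s) x\<bar> \<le> M"
    and lip: "\<And>s x y. \<bar>b (t, s) x - b (t, s) y\<bar> \<le> L * \<bar>x - y\<bar>"
  shows "\<bar>picard b (Suc n) (t, s) x - picard b n (t, s) x\<bar> \<le> M * L ^ n * \<bar>s\<bar> ^ Suc n / fact (Suc n)"
proof (induction n arbitrary: s)
  case 0
  have "continuous_on UNIV (\<lambda>s. b (t, s) x)"
    by (intro fibre_C_time_continuous[OF b t] continuous_intros)
  from prim_bound[OF this, of M 0] bound show ?case by simp
next
  case (Suc n)
  have c: "continuous_on UNIV (\<lambda>s. picard b n (t, s) x)" for n
    by (intro fibre_C_time_continuous[OF fibre_C_picard[OF b] t] continuous_intros)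
  have c': "continuous_on UNIV (\<lambda>s. b (t, s) (picard b n (t, s) x))" for n
    by (intro fibre_C_time_continuous[OF b t] c)
  \<comment> \<open>Nonnegativity of \<open>L\<close> is read off from the Lipschitz bound at two
    points at distance 1.\<close>
  have "0 \<le> L" using lip[of 0 1 0] abs_ge_zero[of "b (t, 0) 1 - b (t, 0) 0"]
    by (simp del: abs_ge_zero)
  have "\<bar>picard b (Suc (Suc n)) (t, s) x - picard b (Suc n) (t, s) x\<bar> =
    \<bar>prim (\<lambda>s. b (t, s) (picard b (Suc n) (t, s) x) - b (t, s) (picard b n (t, s) x)) s\<bar>"
    using prim_diff[OF c'[of "Suc n"] c'[of n]] by simp
  also have "\<dots> \<le> M * L ^ Suc n / fact (Suc n) * \<bar>s\<bar> ^ Suc (Suc n) / Suc (Suc n)"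
  proof (rule prim_bound)
    show "continuous_on UNIV (\<lambda>s. b (t, s) (picard b (Suc n) (t, s) x) - b (t, s) (picard b n (t, s) x))"
      by (intro continuous_on_diff c')
    fix s
    have "\<bar>b (t, s) (picard b (Suc n) (t, s) x) - b (t, s) (picard b n (t, s) x)\<bar> \<le>
      L * \<bar>picard b (Suc n) (t, s) x - picard b n (t, s) x\<bar>"
      by (rule lip)
    also have "\<dots> \<le> L * (M * L ^ n * \<bar>s\<bar> ^ Suc n / fact (Suc n))"
      using \<open>0 \<le> L\<close> by (intro mult_left_mono Suc)
    finally show "\<bar>b (t, s) (picard b (Suc n) (t, s) x) - b (t, s) (picard b n (t, s) x)\<bar> \<le>
      M * L ^ Suc n / fact (Suc n) * \<bar>s\<bar> ^ Suc n"
      by (simp add: algebra_simps)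
  qed
  also have "\<dots> = M * L ^ Suc n * \<bar>s\<bar> ^ Suc (Suc n) / fact (Suc (Suc n))"
    by (simp add: divide_simps)
  finally show ?case .
qed

text \<open>The constants \<open>M\<close> and \<open>L\<close> serve all members, times and points,
  so the iterates converge uniformly on every bounded time interval. This gives joint continuity of
  the limit and permits passing to the limit in the integral equation.\<close>

lemma picard_flow:
  fixes b :: "real \<times> real \<Rightarrow> real \<Rightarrow> real"
  assumes b: "fibre_C 0 (T \<times> UNIV) b"
    and bound: "\<And>t s x. t \<in> T \<Longrightarrow> \<bar>b (t, s) x\<bar> \<le> M"
    and lip: "\<And>t s x y. t \<in> T \<Longrightarrow> \<bar>b (t, s) x - b (t, s) y\<bar> \<le> L * \<bar>x - y\<bar>"
  obtains \<Phi> where "fibre_C 0 (T \<times> UNIV) \<Phi>"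
    "\<And>t s x. t \<in> T \<Longrightarrow> \<Phi> (t, s) x = x + prim (\<lambda>s. b (t, s) (\<Phi> (t, s) x)) s"
proof -
  define d where "d n z = picard b (Suc n) (fst z) (snd z) - picard b n (fst z) (snd z)" for n z
  define \<Phi> where "\<Phi> p x = x + suminf (\<lambda>n. d n (p, x))" for p x
  \<comment> \<open>Only time is bounded in \<open>A R\<close>: the estimates are uniform in the
    starting point and in the member of the family.\<close>
  define A where "A R = {z :: (real \<times> real) \<times> real. fst (fst z) \<in> T \<and> \<bar>snd (fst z)\<bar> \<le> R}" for R
  have ul: "uniform_limit (A R) (\<lambda>n z. picard b n (fst z) (snd z)) (\<lambda>z. \<Phi> (fst z) (snd z)) sequentially" for R
  proof -
    have "uniform_limit (A R) (\<lambda>n z. \<Sum>i<n. d i z) (\<lambda>z. suminf (\<lambda>i. d i z)) sequentially"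
    proof (rule Weierstrass_m_test)
      \<comment> \<open>The majorant keeps \<open>fact n\<close> instead of
        \<open>fact (Suc n)\<close>, which makes it a multiple of the exponential series;
        \<open>\<bar>R\<bar>\<close> covers negative \<open>R\<close> as well.\<close>
      show "summable (\<lambda>n. M * \<bar>R\<bar> * (inverse (fact n) * (L * \<bar>R\<bar>) ^ n))"
        by (intro summable_mult summable_exp)
      fix n z assume z: "z \<in> A R"
      obtain t s x where zt: "z = ((t, s), x)" by (metis prod.collapse)
      have t: "t \<in> T" and s: "\<bar>s\<bar> \<le> \<bar>R\<bar>" using z by (auto simp: A_def zt)
      have M: "0 \<le> M" using bound[OF t, of 0 0] by linarith
      have L: "0 \<le> L" using lip[OF t, of 0 1 0] abs_ge_zero[of "b (t, 0) 1 - b (t, 0) 0"]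
        by (simp del: abs_ge_zero)
      have "norm (d n z) \<le> M * L ^ n * \<bar>s\<bar> ^ Suc n / fact (Suc n)"
        using picard_step[OF b t bound[OF t] lip[OF t]] by (simp add: d_def zt del: picard.simps fact_Suc)
      also have "\<dots> \<le> M * L ^ n * \<bar>R\<bar> ^ Suc n / fact n"
        using M L s by (intro frac_le mult_left_mono power_mono fact_mono) (auto intro!: fact_mono simp del: fact_Suc)
      also have "\<dots> = M * \<bar>R\<bar> * (inverse (fact n) * (L * \<bar>R\<bar>) ^ n)"
        by (simp add: power_mult_distrib divide_inverse)
      finally show "norm (d n z) \<le> M * \<bar>R\<bar> * (inverse (fact n) * (L * \<bar>R\<bar>) ^ n)" .
    qed
    then have "uniform_limit (A R) (\<lambda>n z. snd z + (\<Sum>i<n. d i z)) (\<lambda>z. snd z + suminf (\<lambda>i. d i z)) sequentially"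
      by (intro uniform_limit_add uniform_limit_const)
    moreover have "snd z + (\<Sum>i<n. d i z) = picard b n (fst z) (snd z)" for n z
      unfolding d_def
      using sum_lessThan_telescope[of "\<lambda>i. picard b i (fst z) (snd z)" n] by simp
    ultimately show ?thesis
      by (simp add: \<Phi>_def)
  qed
  have "continuous_on (A R) (\<lambda>z. \<Phi> (fst z) (snd z))" for R
  proof (rule uniform_limit_theorem[OF _ ul])
    show "\<forall>\<^sub>F n in sequentially. continuous_on (A R) (\<lambda>z. picard b n (fst z) (snd z))"
      by (intro always_eventually allI continuous_on_subset[OF fibre_C_continuous[OF fibre_C_picard[OF b]]])
        (auto simp: A_def)
  qed auto
  note cA = this
  have "continuous_on ((T \<times> UNIV) \<times> UNIV) (\<lambda>z. \<Phi> (fst z) (snd z))"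
    unfolding continuous_on_eq_continuous_within
  proof
    fix z :: "(real \<times> real) \<times> real" assume z: "z \<in> (T \<times> UNIV) \<times> UNIV"
    \<comment> \<open>Continuity is local: with one unit of room in time, \<open>A R\<close> agrees
      with the whole domain near \<open>z\<close>.\<close>
    define R where "R = \<bar>snd (fst z)\<bar> + 1"
    have "at z within (T \<times> UNIV) \<times> UNIV = at z within A R"
    proof (rule at_within_nhd)
      show "z \<in> (UNIV \<times> {-R<..<R}) \<times> UNIV" "open ((UNIV \<times> {-R<..<R}) \<times> UNIV :: ((real \<times> real) \<times> real) set)"
        by (cases z; auto simp: R_def intro!: open_Times)+
    qed (auto simp: A_def)
    moreover have "z \<in> A R"
      using z by (auto simp: A_def R_def)
    ultimately show "continuous (at z within (T \<times> UNIV) \<times> UNIV) (\<lambda>z. \<Phi> (fst z) (snd z))"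
      using cA[of R] by (simp add: continuous_on_eq_continuous_within continuous_within)
  qed
  then have \<Phi>: "fibre_C 0 (T \<times> UNIV) \<Phi>" by simp
  have "\<Phi> (t, s) x = x + prim (\<lambda>s. b (t, s) (\<Phi> (t, s) x)) s" if t: "t \<in> T" for t s x
  proof -
    have L: "0 \<le> L" using lip[OF t, of 0 1 0] abs_ge_zero[of "b (t, 0) 1 - b (t, 0) 0"]
      by (simp del: abs_ge_zero)
    have u: "uniform_limit {0..1} (\<lambda>n u. b (t, s * u) (picard b n (t, s * u) x))
      (\<lambda>u. b (t, s * u) (\<Phi> (t, s * u) x)) sequentially"
    proof (rule uniform_limitI)
      fix e :: real assume e: "e > 0"
      \<comment> \<open>Dividing by \<open>L + 1\<close> instead of \<open>L\<close> avoids the case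
        \<open>L = 0\<close>.\<close>
      then have "\<forall>\<^sub>F n in sequentially. \<forall>z\<in>A \<bar>s\<bar>. dist (picard b n (fst z) (snd z)) (\<Phi> (fst z) (snd z)) < e / (L + 1)"
        using L by (intro uniform_limitD[OF ul]) auto
      then show "\<forall>\<^sub>F n in sequentially. \<forall>u\<in>{0..1}. dist (b (t, s * u) (picard b n (t, s * u) x))
           (b (t, s * u) (\<Phi> (t, s * u) x)) < e"
      proof eventually_elim
        case (elim n)
        show ?case
        proof
          fix u :: real assume u: "u \<in> {0..1}"
          then have "((t, s * u), x) \<in> A \<bar>s\<bar>"
            using t by (auto simp: A_def abs_mult intro!: mult_left_le)
          from bspec[OF elim this] have le: "\<bar>picard b n (t, s * u) x - \<Phi> (t, s * u) x\<bar> < e / (L + 1)"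
            by (simp add: dist_real_def)
          have "\<bar>b (t, s * u) (picard b n (t, s * u) x) - b (t, s * u) (\<Phi> (t, s * u) x)\<bar> \<le> 
            L * \<bar>picard b n (t, s * u) x - \<Phi> (t, s * u) x\<bar>"
            by (rule lip[OF t])
          also have "\<dots> \<le> L * (e / (L + 1))"
            using L le by (intro mult_left_mono) auto
          also have "\<dots> < e" using L e by (simp add: field_simps)
          finally show "dist (b (t, s * u) (picard b n (t, s * u) x)) (b (t, s * u) (\<Phi> (t, s * u) x)) < e"
            by (simp add: dist_real_def)
        qed
      qed
    qed
    have c: "continuous_on {0..1} (\<lambda>u. b (t, s * u) (picard b n (t, s * u) x))" for n
    proof -
      have "continuous_on UNIV (\<lambda>s. b (t, s) (picard b n (t, s) x))"
        by (intro fibre_C_time_continuous[OF b t] fibre_C_time_continuous[OF fibre_C_picard[OF b] t]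
          continuous_intros)
      then show ?thesis
        by (rule continuous_on_compose2) (auto intro!: continuous_intros)
    qed
    obtain I J where I: "\<And>n. ((\<lambda>u. b (t, s * u) (picard b n (t, s * u) x)) has_integral I n) {0..1}"
      and J: "((\<lambda>u. b (t, s * u) (\<Phi> (t, s * u) x)) has_integral J) {0..1}" and IJ: "I \<longlonglongrightarrow> J"
      using uniform_limit_integral[OF u c] by auto
    have "(\<lambda>n. x + s * I n) \<longlonglongrightarrow> x + s * J"
      by (intro tendsto_intros IJ)
    moreover have "x + s * I n = picard b (Suc n) (t, s) x" for n
      using integral_unique[OF I] by (simp add: prim_def)
    moreover have "(\<lambda>n. picard b (Suc n) (t, s) x) \<longlonglongrightarrow> \<Phi> (t, s) x"
      using tendsto_uniform_limitI[OF ul[of "\<bar>s\<bar>"], of "((t, s), x)"] t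
      by (intro LIMSEQ_Suc) (simp add: A_def)
    ultimately have "\<Phi> (t, s) x = x + s * J"
      using LIMSEQ_unique by auto
    then show ?thesis
      using integral_unique[OF J] by (simp add: prim_def)
  qed
  with \<Phi> show ?thesis using that by blast
qed

section \<open>From fibrewise derivatives to smooth maps; periodic functions\<close>

lemma frechet_derivative_real_one:
  assumes "(g has_real_derivative d) (at x)"
  shows "frechet_derivative g (at x) 1 = d"
proof -
  have "(*) d = frechet_derivative g (at x)"
    using frechet_derivative_at assms by (simp add: has_field_derivative_def)
  from fun_cong[OF this, of 1] show ?thesis by simp
qed

lemma fibre_C_iter_deriv:
  assumes "\<And>k. fibre_C k S f" "vs \<in> lists Basis"
  shows "fibre_C k S (\<lambda>p. iter_deriv vs (f p))"
  using assms(2)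
proof (induction vs arbitrary: k)
  case Nil
  then show ?case by (simp add: assms(1))
next
  case (Cons v vs)
  then have v: "v = 1" and IH: "\<And>k. fibre_C k S (\<lambda>p. iter_deriv vs (f p))"
    by auto
  have "fibre_C k S (\<lambda>p. deriv (iter_deriv vs (f p)))"
    using IH[of "Suc k"] by simp
  moreover have "iter_deriv (v # vs) (f p) = deriv (iter_deriv vs (f p))" if "p \<in> S" for p
    using frechet_derivative_real_one[OF fibre_C_deriv[OF IH[of 1, unfolded One_nat_def] that]] 
    by (auto simp: v)
  ultimately show ?case
    using fibre_C_cong[of S "\<lambda>p. iter_deriv (v # vs) (f p)"] by simp
qed

lemma fibre_C_smooth:
  assumes "\<And>k. fibre_C k S f" "p \<in> S"
  shows "smooth (f p)"
  unfolding smooth_open_def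
proof (intro conjI ballI)
  fix vs :: "real list" and x :: real assume "vs \<in> lists Basis"
  from fibre_C_iter_deriv[OF assms(1) this, of "Suc 0"] assms(2)
  show "iter_deriv vs (f p) differentiable at x"
    by (auto intro: field_differentiable_imp_differentiable)
qed simp

lemma periodic_frac:
  fixes f :: "real \<Rightarrow> 'a"
  assumes "\<And>x. f (x + 1) = f x"
  shows "f (frac x) = f x"
proof -
  have "f (x + of_int n) = f x" for n :: int and x
  proof (induction n rule: int_induct[of _ 0])
    case (step1 i)
    then show ?case using assms[of "x + of_int i"] by (simp add: add.assoc)
  next
    case (step2 i)
    then show ?case using assms[of "x + of_int (i - 1)"] by (simp add: algebra_simps)
  qed simp
  from this[of x "- \<lfloor>x\<rfloor>"] show ?thesis
    by (simp add: frac_def)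
qed

lemma deriv_periodic:
  fixes f :: "real \<Rightarrow> real"
  assumes "\<And>x. f (x + 1) = f x" "\<And>x. (f has_real_derivative deriv f x) (at x)"
  shows "deriv f (x + 1) = deriv f x"
proof -
  have "((\<lambda>x. f (x + 1)) has_real_derivative deriv f (x + 1)) (at x)"
    using assms(2) DERIV_shift by blast
  then show ?thesis
    using assms(1) by (simp add: DERIV_imp_deriv)
qed

text \<open>Reducing time and space to their fractional parts leaves a continuous function on the
  compact set \<open>(T \<times> {0..1}) \<times> {0..1}\<close>.\<close>

lemma fibre_C_periodic_bounded:
  fixes f :: "'q::topological_space \<times> real \<Rightarrow> real \<Rightarrow> real"
  assumes "fibre_C k (T \<times> UNIV) f" "compact T"
    and "\<And>t s x. t \<in> T \<Longrightarrow> f (t, s + 1) x = f (t, s) x"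
    and "\<And>t s x. t \<in> T \<Longrightarrow> f (t, s) (x + 1) = f (t, s) x"
  obtains M where "\<And>t s x. t \<in> T \<Longrightarrow> \<bar>f (t, s) x\<bar> \<le> M"
proof -
  let ?K = "(T \<times> {0..1::real}) \<times> {0..1::real}"
  have "compact ((\<lambda>z. f (fst z) (snd z)) ` ?K)"
    by (intro compact_continuous_image compact_Times assms(2)
      continuous_on_subset[OF fibre_C_continuous[OF assms(1)]]) auto
  then obtain M where M: "\<And>z. z \<in> ?K \<Longrightarrow> \<bar>f (fst z) (snd z)\<bar> \<le> M"
    by (metis (no_types, lifting) bounded_real compact_imp_bounded imageI)
  have "\<bar>f (t, s) x\<bar> \<le> M" if t: "t \<in> T" for t s x
  proof -
    have "f (t, s) x = f (t, frac s) (frac x)"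
      using periodic_frac[of "\<lambda>s. f (t, s) x"] periodic_frac[of "f (t, frac s)"] assms(3,4)[OF t] by simp
    then show ?thesis
      using M[of "((t, frac s), frac x)"] t frac_lt_1[of s] frac_lt_1[of x] by (auto simp: less_imp_le)
  qed
  then show ?thesis using that by blast
qed

lemma prim_zero: "prim (\<lambda>_. 0) t = 0"
  by (simp add: prim_def)

section \<open>The flow of a compact family of doubly periodic fields\<close>

locale periodic_family =
  fixes T :: "real set" and b :: "real \<times> real \<Rightarrow> real \<Rightarrow> real"
  assumes compact_T: "compact T"
    and smooth_b: "\<And>k. fibre_C k (T \<times> UNIV) b"
    and periodic_time: "\<And>t s x. t \<in> T \<Longrightarrow> b (t, s + 1) x = b (t, s) x"
    and periodic_space: "\<And>t s x. t \<in> T \<Longrightarrow> b (t, s) (x + 1) = b (t, s) x"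
begin

lemma b_deriv: "t \<in> T \<Longrightarrow> (b (t, s) has_real_derivative deriv (b (t, s)) x) (at x)"
  using fibre_C_deriv[OF smooth_b] by auto

lemma b_diff: "t \<in> T \<Longrightarrow> b (t, s) y - b (t, s) x = hadamard (b (t, s)) x y * (y - x)"
  by (intro hadamard_eq b_deriv)

lemma ex_bound: "\<exists>M. \<forall>t\<in>T. \<forall>s x. \<bar>b (t, s) x\<bar> \<le> M"
proof (rule fibre_C_periodic_bounded[OF smooth_b[of 0] compact_T])
  fix M assume "\<And>t s x. t \<in> T \<Longrightarrow> \<bar>b (t, s) x\<bar> \<le> M"
  then show ?thesis by blast
qed (simp_all add: periodic_time periodic_space)

lemma ex_lipschitz: "\<exists>L. \<forall>t\<in>T. \<forall>s x y. \<bar>b (t, s) x - b (t, s) y\<bar> \<le> L * \<bar>x - y\<bar>"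
proof -
  have c: "fibre_C 0 (T \<times> UNIV) (\<lambda>p. deriv (b p))"
    using smooth_b[of "Suc 0"] by simp
  obtain L where L: "\<And>t s x. t \<in> T \<Longrightarrow> \<bar>deriv (b (t, s)) x\<bar> \<le> L"
  proof (rule fibre_C_periodic_bounded[OF c compact_T])
    show "deriv (b (t, s + 1)) x = deriv (b (t, s)) x" if "t \<in> T" for t s x
      using periodic_time[OF that] by presburger
    show "deriv (b (t, s)) (x + 1) = deriv (b (t, s)) x" if "t \<in> T" for t s x
      by (intro deriv_periodic b_deriv periodic_space that)
    fix M assume "\<And>t s x. t \<in> T \<Longrightarrow> \<bar>deriv (b (t, s)) x\<bar> \<le> M"
    then show thesis by (rule that)
  qed
  have "\<bar>b (t, s) x - b (t, s) y\<bar> \<le> L * \<bar>x - y\<bar>" if "t \<in> T" for t s x y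
    using field_differentiable_bound[of UNIV "b (t, s)" "deriv (b (t, s))" L x y] b_deriv[OF that] L[OF that]
    by simp
  then show ?thesis by blast
qed

text \<open>The choice is constrained only for members in \<open>T\<close>; there
  \<open>Phi_unique\<close> shows that nothing is left to choose.\<close>

definition Phi :: "real \<times> real \<Rightarrow> real \<Rightarrow> real" where
  "Phi = (SOME \<Phi>. fibre_C 0 (T \<times> UNIV) \<Phi> \<and>
     (\<forall>t s x. t \<in> T \<longrightarrow> \<Phi> (t, s) x = x + prim (\<lambda>s. b (t, s) (\<Phi> (t, s) x)) s))"

lemma Phi_props:
  shows Phi_continuous: "fibre_C 0 (T \<times> UNIV) Phi"
    and Phi_eq: "t \<in> T \<Longrightarrow> Phi (t, s) x = x + prim (\<lambda>s. b (t, s) (Phi (t, s) x)) s"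
proof -
  obtain M where M: "\<And>t s x. t \<in> T \<Longrightarrow> \<bar>b (t, s) x\<bar> \<le> M"
    using ex_bound by blast
  obtain L where L: "\<And>t s x y. t \<in> T \<Longrightarrow> \<bar>b (t, s) x - b (t, s) y\<bar> \<le> L * \<bar>x - y\<bar>"
    using ex_lipschitz by blast
  have "\<exists>\<Phi>. fibre_C 0 (T \<times> UNIV) \<Phi> \<and>
     (\<forall>t s x. t \<in> T \<longrightarrow> \<Phi> (t, s) x = x + prim (\<lambda>s. b (t, s) (\<Phi> (t, s) x)) s)"
    by (rule picard_flow[OF smooth_b[of 0] M L]) blast+
  from someI_ex[OF this]
  have *: "fibre_C 0 (T \<times> UNIV) Phi \<and>
     (\<forall>t s x. t \<in> T \<longrightarrow> Phi (t, s) x = x + prim (\<lambda>s. b (t, s) (Phi (t, s) x)) s)"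
    unfolding Phi_def[symmetric] .
  show "fibre_C 0 (T \<times> UNIV) Phi" using * by blast
  show "t \<in> T \<Longrightarrow> Phi (t, s) x = x + prim (\<lambda>s. b (t, s) (Phi (t, s) x)) s"
    using * by blast
qed

lemma Phi_0: "t \<in> T \<Longrightarrow> Phi (t, 0) x = x"
  by (subst Phi_eq) auto

lemma Phi_time_continuous: "t \<in> T \<Longrightarrow> continuous_on UNIV (\<lambda>s. Phi (t, s) x)"
  by (intro fibre_C_time_continuous[OF Phi_continuous] continuous_intros)

lemma Phi_time_deriv:
  assumes "t \<in> T"
  shows "((\<lambda>s. Phi (t, s) x) has_real_derivative b (t, s) (Phi (t, s) x)) (at s)"
proof -
  have "continuous_on UNIV (\<lambda>s. b (t, s) (Phi (t, s) x))"
    by (intro fibre_C_time_continuous[OF smooth_b assms] Phi_time_continuous assms)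
  from DERIV_add[OF DERIV_const[of x] prim_has_derivative[OF this]] show ?thesis
    by (simp flip: Phi_eq[OF assms])
qed

text \<open>The difference of two solutions satisfies a homogeneous linear equation whose
  coefficient is the Hadamard quotient of the field between them. Equal initial values give
  uniqueness; unequal ones give an exact formula for the difference quotient of the flow.\<close>

lemma solutions_diff:
  assumes t: "t \<in> T"
    and y: "\<And>s. (y has_real_derivative b (t, s) (y s)) (at s)"
    and z: "\<And>s. (z has_real_derivative b (t, s) (z s)) (at s)"
  shows "y s - z s = (y 0 - z 0) * exp (prim (\<lambda>s. hadamard (b (t, s)) (z s) (y s)) s)"
proof -
  have c: "continuous_on UNIV y" "continuous_on UNIV z"
    using y z by (meson DERIV_isCont continuous_at_imp_continuous_on)+
  have "fibre_C (Suc 0) UNIV (\<lambda>s. b (t, s))"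
    by (rule fibre_C_reparam[OF smooth_b[of "Suc 0"]]) (use t in \<open>auto intro!: continuous_intros\<close>)
  note H = fibre_C_continuous[OF fibre_C_hadamard[OF this fibre_C_param[OF c(2)] fibre_C_param[OF c(1)]]]
  \<comment> \<open>The endpoints were entered as functions constant in the space variable, so
    evaluating along the points \<open>(s, 0)\<close> loses nothing.\<close>
  have "continuous_on UNIV (\<lambda>s::real. (s, 0::real))"
    by (intro continuous_intros)
  from continuous_on_compose2[OF H this] have h: "continuous_on UNIV (\<lambda>s. hadamard (b (t, s)) (z s) (y s))"
    by simp
  have "((\<lambda>s. y s - z s) has_real_derivative
    hadamard (b (t, s)) (z s) (y s) * (y s - z s) + 0) (at s)" for s
    using DERIV_diff[OF y[of s] z[of s]] b_diff[OF t, of s "y s" "z s"] by simp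
  from linear_ode[OF h continuous_on_const[of _ 0] this, of s] show ?thesis
    by (simp add: prim_zero mult.commute)
qed

lemma Phi_unique:
  assumes "t \<in> T" "\<And>s. (y has_real_derivative b (t, s) (y s)) (at s)"
  shows "y s = Phi (t, s) (y 0)"
  using solutions_diff[OF assms(1) assms(2) Phi_time_deriv[OF assms(1)], of s "y 0"] Phi_0[OF assms(1)]
  by simp

lemma Phi_shift:
  assumes "t \<in> T"
  shows "Phi (t, s) (x + 1) = Phi (t, s) x + 1"
proof -
  have "((\<lambda>s. Phi (t, s) x + 1) has_real_derivative b (t, s) (Phi (t, s) x + 1)) (at s)" for s
    using DERIV_add[OF Phi_time_deriv[OF assms] DERIV_const[of 1]] periodic_space[OF assms] by simp
  from Phi_unique[OF assms this, of s] show ?thesis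
    using Phi_0[OF assms] by simp
qed

text \<open>Caratheodory's criterion: by \<open>solutions_diff\<close> the difference quotient
  between \<open>x\<close> and \<open>y\<close> is the exponential of an integral of Hadamard
  quotients. Continuity of the flow makes this continuous in \<open>y\<close>, and at
  \<open>y = x\<close> the quotient becomes \<open>deriv\<close>.\<close>

lemma Phi_deriv:
  assumes t: "t \<in> T"
  shows "(Phi (t, s) has_real_derivative
    exp (prim (\<lambda>s. deriv (b (t, s)) (Phi (t, s) x)) s)) (at x)"
proof -
  define h where "h p y = hadamard (b p) (Phi (fst p, snd p) x) (Phi p y)" for p y
  have "continuous_on (T \<times> UNIV) (\<lambda>p. (p, x))"
    by (intro continuous_intros)
  from continuous_on_compose2[OF fibre_C_continuous[OF Phi_continuous] this]
  have "fibre_C 0 (T \<times> UNIV) (\<lambda>p (y::real). Phi (fst p, snd p) x)"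
    by (intro fibre_C_param) auto
  then have "fibre_C 0 (T \<times> UNIV) h"
    unfolding h_def using fibre_C_hadamard smooth_b Phi_continuous by blast
  from fibre_C_continuous[OF fibre_C_prim[OF this]]
  have "continuous_on UNIV (\<lambda>y. (\<lambda>z. prim (\<lambda>s. h (fst (fst z), s) (snd z)) (snd (fst z))) ((t, s), y))"
    by (rule continuous_on_compose2) (use t in \<open>auto intro!: continuous_intros\<close>)
  then have "isCont (\<lambda>y. exp (prim (\<lambda>s. h (t, s) y) s)) x"
    by (auto intro!: continuous_intros simp: continuous_on_eq_continuous_at)
  moreover have "Phi (t, s) y - Phi (t, s) x = exp (prim (\<lambda>s. h (t, s) y) s) * (y - x)" for y
    using solutions_diff[OF t Phi_time_deriv[OF t] Phi_time_deriv[OF t]]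
    by (simp add: h_def Phi_0[OF t] mult.commute)
  ultimately show ?thesis
    unfolding CARAT_DERIV by (intro exI[of _ "\<lambda>y. exp (prim (\<lambda>s. h (t, s) y) s)"]) (simp add: h_def)
qed

text \<open>Bootstrapping: by \<open>Phi_deriv\<close> the derivative of the flow is as regular as the flow itself.\<close>

lemma Phi_smooth: "fibre_C k (T \<times> UNIV) Phi"
proof (induction k)
  case 0
  show ?case by (rule Phi_continuous)
next
  case (Suc k)
  have "fibre_C k (T \<times> UNIV) (\<lambda>p. deriv (b p))"
    using smooth_b[of "Suc k"] by simp
  from fibre_C_exp[OF fibre_C_prim[OF fibre_C_comp[OF this Suc]]]
  have "fibre_C k (T \<times> UNIV) (\<lambda>p x. exp (prim (\<lambda>s. deriv (b (fst p, s)) (Phi (fst p, s) x)) (snd p)))" .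
  then show ?case
    using Phi_deriv by (intro fibre_C_SucI[OF fibre_C_continuous[OF Phi_continuous]]) auto
qed

end

text \<open>Carries an expansion of first order in \<open>t\<close> over to every iterated
  derivative in \<theta>.\<close>

lemma iter_deriv_add_scale:
  assumes "smooth g" "smooth q" "vs \<in> lists Basis"
  shows "iter_deriv vs (\<lambda>x. g x + c *\<^sub>R q x) = (\<lambda>x. iter_deriv vs g x + c *\<^sub>R iter_deriv vs q x)"
  using assms(3)
proof (induction vs)
  case Nil
  then show ?case by simp
next
  case (Cons v vs)
  then have vs: "vs \<in> lists Basis" by simp
  show ?case
  proof
    fix x
    have "iter_deriv vs g differentiable at x" "iter_deriv vs q differentiable at x"
      using assms(1,2) vs by (auto simp: smooth_open_def)
    then have "((\<lambda>x. iter_deriv vs g x + c *\<^sub>R iter_deriv vs q x) has_derivative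
      (\<lambda>v. frechet_derivative (iter_deriv vs g) (at x) v +
         c *\<^sub>R frechet_derivative (iter_deriv vs q) (at x) v)) (at x)"
      by (auto intro!: derivative_eq_intros simp: frechet_derivative_works)
    from frechet_derivative_at[OF this, symmetric]
    show "iter_deriv (v # vs) (\<lambda>x. g x + c *\<^sub>R q x) x =
      iter_deriv (v # vs) g x + c *\<^sub>R iter_deriv (v # vs) q x"
      using Cons.IH by simp
  qed
qed

text \<open>Joint continuity is uniform on the compact set
  \<open>(T \<times> {s}) \<times> K\<close>, so convergence of the parameter gives uniform
  convergence on \<open>K\<close>.\<close>

lemma fibre_C_uniform_limit:
  fixes f :: "real \<times> real \<Rightarrow> real \<Rightarrow> real"
  assumes "fibre_C k (T \<times> UNIV) f" "compact T" "compact K" "\<And>n. \<tau> n \<in> T" "l \<in> T" "\<tau> \<longlonglongrightarrow> l"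
  shows "uniform_limit K (\<lambda>n. f (\<tau> n, s)) (f (l, s)) sequentially"
proof (rule uniform_limitI)
  fix e :: real assume "e > 0"
  let ?C = "(T \<times> {s}) \<times> K"
  have "uniformly_continuous_on ?C (\<lambda>z. f (fst z) (snd z))"
    by (intro compact_uniformly_continuous compact_Times assms(2,3) compact_sing
      continuous_on_subset[OF fibre_C_continuous[OF assms(1)]]) auto
  then obtain d where d: "d > 0" "\<And>z z'. z \<in> ?C \<Longrightarrow> z' \<in> ?C \<Longrightarrow> dist z' z < d \<Longrightarrow>
    dist (f (fst z') (snd z')) (f (fst z) (snd z)) < e"
    using \<open>e > 0\<close> unfolding uniformly_continuous_on_def by metis
  have "\<forall>\<^sub>F n in sequentially. dist (\<tau> n) l < d"
    using assms(6) d(1) by (rule tendstoD)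
  then show "\<forall>\<^sub>F n in sequentially. \<forall>x\<in>K. dist (f (\<tau> n, s) x) (f (l, s) x) < e"
  proof eventually_elim
    case (elim n)
    show ?case
    proof
      fix x assume "x \<in> K"
      then show "dist (f (\<tau> n, s) x) (f (l, s) x) < e"
        using d(2)[of "((l, s), x)" "((\<tau> n, s), x)"] elim assms(4,5) by (simp add: dist_Pair_Pair)
    qed
  qed
qed

section \<open>The time-one map as a diffeomorphism of the circle\<close>

context periodic_family
begin

text \<open>The equivalence gives existence and uniqueness together, as needed to evaluate the
  definite description in \<open>flow\<close>.\<close>

lemma is_flow_iff:
  assumes "t \<in> T"
  shows "is_flow (\<lambda>z. b (t, fst z) (snd z)) \<Psi> \<longleftrightarrow> \<Psi> = (\<lambda>s. Phi (t, s))"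
proof
  assume f: "is_flow (\<lambda>z. b (t, fst z) (snd z)) \<Psi>"
  show "\<Psi> = (\<lambda>s. Phi (t, s))"
  proof (intro ext)
    fix s x
    show "\<Psi> s x = Phi (t, s) x"
      using Phi_unique[OF assms, of "\<lambda>s. \<Psi> s x" s] f by (simp add: is_flow_def)
  qed
next
  assume "\<Psi> = (\<lambda>s. Phi (t, s))"
  then show "is_flow (\<lambda>z. b (t, fst z) (snd z)) \<Psi>"
    using Phi_0[OF assms] Phi_time_deriv[OF assms] by (simp add: is_flow_def)
qed

text \<open>The derivative is an exponential, so the map is strictly increasing; it moves points by
  at most \<open>M\<close>, so the intermediate value theorem on \<open>{y - M..y + M}\<close> makes
  it onto. The inverse \<open>g\<close> satisfies \<open>g' = exp (- a (g y))\<close>, which raises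
  its regularity one order at a time.\<close>

lemma circle_diffeo_Phi:
  assumes t: "t \<in> T"
  shows "circle_diffeo (Phi (t, 1))"
proof -
  define f where "f = Phi (t, 1)"
  define a where "a x = prim (\<lambda>s. deriv (b (t, s)) (Phi (t, s) x)) 1" for x
  have f': "(f has_real_derivative exp (a x)) (at x)" for x
    unfolding f_def a_def by (rule Phi_deriv[OF t])
  \<comment> \<open>The one-point parameter set \<open>{0}\<close> is a dummy that turns
    \<open>fibre_C\<close> into C^k regularity of a single function.\<close>
  have a: "fibre_C k {0::real} (\<lambda>_. a)" for k
  proof -
    have "fibre_C k (T \<times> UNIV) (\<lambda>p. deriv (b p))"
      using smooth_b[of "Suc k"] by simp
    from fibre_C_reparam[OF fibre_C_prim[OF fibre_C_comp[OF this Phi_smooth]], of "{0::real}" "\<lambda>_. (t, 1)"]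
    show ?thesis using t by (simp add: a_def[abs_def])
  qed
  have less: "f x < f y" if "x < y" for x y
    by (rule DERIV_pos_imp_increasing[OF that]) (use f' exp_gt_zero in blast)
  then have mono: "f x \<le> f y \<longleftrightarrow> x \<le> y" for x y
    by (metis less_le_not_le linorder_le_less_linear order_le_less)
  then have "inj f" by (metis injI order_antisym order_refl)
  have "\<exists>x. y = f x" for y
  proof -
    obtain M where M: "\<And>s x. \<bar>b (t, s) x\<bar> \<le> M" using ex_bound t by blast
    have fx: "\<bar>f x - x\<bar> \<le> M" for x
    proof -
      have "continuous_on UNIV (\<lambda>s. b (t, s) (Phi (t, s) x))"
        by (intro fibre_C_time_continuous[OF smooth_b t] Phi_time_continuous t)
      from prim_bound[OF this, of M 0 1] M show ?thesis
        using Phi_eq[OF t, of 1 x] by (simp add: f_def)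
    qed
    have "f (y - M) \<le> y" "y \<le> f (y + M)" "y - M \<le> y + M"
      using fx[of "y - M"] fx[of "y + M"] M[of 0 0] by linarith+
    then show ?thesis
      using IVT[of f "y - M" y "y + M"] DERIV_isCont[OF f'] by metis
  qed
  then have "surj f" by (simp add: surj_def)
  note bij = bijI[OF \<open>inj f\<close> \<open>surj f\<close>]
  define g where "g = inv_into UNIV f"
  have fg: "f (g y) = y" for y
    by (simp add: g_def surj_f_inv_f[OF \<open>surj f\<close>])
  have "range g = UNIV"
    using bij_imp_bij_inv[OF bij] by (simp add: g_def bij_def)
  moreover have "g x \<le> g y" if "x \<le> y" for x y
    using mono[of "g x" "g y"] that by (simp add: fg)
  \<comment> \<open>A monotone function with open range has no jumps.\<close>
  ultimately have g_cont: "continuous_on UNIV g"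
    by (intro continuous_onI_mono) simp_all
  have g': "(g has_real_derivative exp (- a (g y))) (at y)" for y
  proof -
    have "(g has_real_derivative inverse (exp (a (g y)))) (at y)"
    proof (rule DERIV_inverse_function[where f = f and a = "y - 1" and b = "y + 1"])
      show "(f has_real_derivative exp (a (g y))) (at (g y))" by (rule f')
      show "isCont g y" using g_cont by (simp add: continuous_on_eq_continuous_at)
    qed (simp_all add: fg)
    then show ?thesis by (simp add: exp_minus)
  qed
  have "continuous_on ({0::real} \<times> UNIV) (\<lambda>z. g (snd z))"
    by (intro continuous_on_compose2[OF g_cont] continuous_intros) auto
  then have "fibre_C k {0::real} (\<lambda>_. g)" for k
  proof (induction k)
    case (Suc k)
    have "fibre_C k {0::real} (\<lambda>_ y. exp (- a (g y)))"
      using fibre_C_exp[OF fibre_C_minus[OF fibre_C_comp[OF a Suc.IH]]] Suc.prems by simp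
    then show ?case
      using Suc.prems by (intro fibre_C_SucI[where g = "\<lambda>_ y. exp (- a (g y))"]) (auto intro: g')
  qed simp
  from fibre_C_smooth[OF this, of 0] have "smooth g" by simp
  moreover have "smooth f"
    unfolding f_def using t by (intro fibre_C_smooth[OF Phi_smooth]) auto
  ultimately show ?thesis
    using bij Phi_shift[OF t] by (simp add: circle_diffeo_def diffeomorphism_def g_def f_def)
qed

end

section \<open>The difference quotient of the flow in \<open>t\<close>\<close>

locale differentiable_family = periodic_family +
  fixes \<beta> :: "real \<times> real \<Rightarrow> real \<Rightarrow> real"
  assumes zero_in_T: "0 \<in> T"
    and smooth_beta: "\<And>k. fibre_C k (T \<times> UNIV) \<beta>"
    and b_expansion: "\<And>t s x. t \<in> T \<Longrightarrow> b (t, s) x = b (0, s) x + t * \<beta> (t, s) x"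
begin

text \<open>Exponent of the integrating factor for the difference of the flows of members
  \<open>t\<close> and 0. At \<open>t = 0\<close> it is the logarithm of the \<theta>-derivative of
  the unperturbed flow.\<close>

definition growth :: "real \<times> real \<Rightarrow> real \<Rightarrow> real" where
  "growth p x = prim (\<lambda>s. hadamard (b (0, s)) (Phi (0, s) x) (Phi (fst p, s) x)) (snd p)"

text \<open>Variation of constants with source \<beta> in place of \<open>t * \<beta>\<close>: the
  division by \<open>t\<close> has already taken place, so the formula keeps its meaning at
  \<open>t = 0\<close>.\<close>

definition Phi_quotient :: "real \<times> real \<Rightarrow> real \<Rightarrow> real" where
  "Phi_quotient p x = exp (growth p x) * prim (\<lambda>s. exp (- growth (fst p, s) x) * \<beta> (fst p, s) (Phi (fst p, s) x)) (snd p)"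

lemma fibre_C_at_zero:
  assumes "fibre_C k (T \<times> UNIV) f"
  shows "fibre_C k (T \<times> UNIV) (\<lambda>p. f (0, snd p))"
  by (rule fibre_C_reparam[OF assms]) (auto intro!: continuous_intros simp: zero_in_T)

lemma smooth_hadamard: "fibre_C k (T \<times> UNIV) (\<lambda>p x. hadamard (b (0, snd p)) (Phi (0, snd p) x) (Phi p x))"
  by (rule fibre_C_hadamard[OF fibre_C_at_zero[OF smooth_b] fibre_C_at_zero[OF Phi_smooth] Phi_smooth])

lemma smooth_growth: "fibre_C k (T \<times> UNIV) growth"
  using fibre_C_prim[OF smooth_hadamard] by (simp add: growth_def[abs_def])

lemma smooth_Phi_quotient_integrand:
  "fibre_C k (T \<times> UNIV) (\<lambda>p x. exp (- growth p x) * \<beta> p (Phi p x))"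
  by (rule fibre_C_mult[OF fibre_C_exp[OF fibre_C_minus[OF smooth_growth]] fibre_C_comp[OF smooth_beta Phi_smooth]])

lemma smooth_Phi_quotient: "fibre_C k (T \<times> UNIV) Phi_quotient"
  using fibre_C_mult[OF fibre_C_exp[OF smooth_growth] fibre_C_prim[OF smooth_Phi_quotient_integrand]]
  by (simp add: Phi_quotient_def[abs_def])

lemma Phi_expansion:
  assumes t: "t \<in> T"
  shows "Phi (t, s) x = Phi (0, s) x + t * Phi_quotient (t, s) x"
proof -
  define c where "c s = hadamard (b (0, s)) (Phi (0, s) x) (Phi (t, s) x)" for s
  have c: "continuous_on UNIV c"
    using fibre_C_time_continuous[OF smooth_hadamard t continuous_on_const] by (simp add: c_def[abs_def])
  have d: "continuous_on UNIV (\<lambda>s. t * \<beta> (t, s) (Phi (t, s) x))"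
    by (intro continuous_intros fibre_C_time_continuous[OF smooth_beta t] Phi_time_continuous t)
  have "((\<lambda>s. Phi (t, s) x - Phi (0, s) x) has_real_derivative
     c s * (Phi (t, s) x - Phi (0, s) x) + t * \<beta> (t, s) (Phi (t, s) x)) (at s)" for s
  proof -
    \<comment> \<open>Inserting \<open>b (0, s) (Phi (t, s) x)\<close> splits the difference into
      the change of trajectory under the unperturbed field and the change of field along the
      perturbed trajectory.\<close>
    have "b (t, s) (Phi (t, s) x) - b (0, s) (Phi (0, s) x) =
       c s * (Phi (t, s) x - Phi (0, s) x) + t * \<beta> (t, s) (Phi (t, s) x)"
      using b_diff[OF zero_in_T, of s "Phi (t, s) x" "Phi (0, s) x"] b_expansion[OF t, of s "Phi (t, s) x"]
      by (simp add: c_def)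
    with DERIV_diff[OF Phi_time_deriv[OF t] Phi_time_deriv[OF zero_in_T], of x x s] show ?thesis
      by simp
  qed
  from linear_ode[OF c d this, of s]
  have "Phi (t, s) x - Phi (0, s) x =
    exp (growth (t, s) x) * prim (\<lambda>s. t * (exp (- growth (t, s) x) * \<beta> (t, s) (Phi (t, s) x))) s"
    by (simp add: Phi_0 t zero_in_T growth_def c_def mult.left_commute)
  then show ?thesis
    by (simp add: prim_cmult Phi_quotient_def algebra_simps)
qed

text \<open>At \<open>t = 0\<close> the Hadamard quotients are derivatives, and the exponents up to
  time 1 and up to time \<open>s\<close> differ by the integral over \<open>{s..1}\<close>; this
  produces the propagator in the stated formula.\<close>

lemma Phi_quotient_at_zero:
  "Phi_quotient (0, 1) x = integral {0..1} (\<lambda>s. exp (integral {s..1} (\<lambda>r. deriv (b (0, r)) (Phi (0, r) x)))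
     * \<beta> (0, s) (Phi (0, s) x))"
proof -
  have "continuous_on UNIV (\<lambda>r. hadamard (b (0, r)) (Phi (0, r) x) (Phi (0, r) x))"
    using fibre_C_time_continuous[OF smooth_hadamard zero_in_T continuous_on_const] by simp
  then have "continuous_on UNIV (\<lambda>r. deriv (b (0, r)) (Phi (0, r) x))" by simp
  from prim_eq_integral[OF this]
  have diff: "growth (0, 1) x - growth (0, s) x = integral {s..1} (\<lambda>r. deriv (b (0, r)) (Phi (0, r) x))" if "s \<le> 1" for s
    using that by (simp add: growth_def)
  have "Phi_quotient (0, 1) x = integral {0..1} (\<lambda>s. exp (growth (0, 1) x) * (exp (- growth (0, s) x) * \<beta> (0, s) (Phi (0, s) x)))"
    by (simp add: Phi_quotient_def prim_def)
  also have "\<dots> = integral {0..1} (\<lambda>s. exp (integral {s..1} (\<lambda>r. deriv (b (0, r)) (Phi (0, r) x)))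
     * \<beta> (0, s) (Phi (0, s) x))"
  proof (rule Henstock_Kurzweil_Integration.integral_cong)
    fix s :: real assume "s \<in> {0..1}"
    then show "exp (growth (0, 1) x) * (exp (- growth (0, s) x) * \<beta> (0, s) (Phi (0, s) x)) =
      exp (integral {s..1} (\<lambda>r. deriv (b (0, r)) (Phi (0, r) x))) * \<beta> (0, s) (Phi (0, s) x)"
      using diff[of s] by (simp add: exp_diff exp_minus divide_inverse flip: diff)
  qed
  finally show ?thesis .
qed

text \<open>For nonzero \<open>t\<close> in \<open>T\<close> the quotient of iterated derivatives is
  exactly the iterated derivative of \<open>Phi_quotient (t, 1)\<close>, so its limit is a matter of
  continuity in the parameter.\<close>

lemma Phi_quotient_uniform_limit:
  assumes "compact K" "vs \<in> lists Basis" "\<And>n. \<tau> n \<in> T" "\<And>n. \<tau> n \<noteq> 0" "\<tau> \<longlonglongrightarrow> 0"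
  shows "uniform_limit K (\<lambda>n x. (iter_deriv vs (Phi (\<tau> n, 1)) x - iter_deriv vs (Phi (0, 1)) x) /\<^sub>R \<tau> n)
    (iter_deriv vs (Phi_quotient (0, 1))) sequentially"
proof -
  have "(iter_deriv vs (Phi (t, 1)) x - iter_deriv vs (Phi (0, 1)) x) /\<^sub>R t = iter_deriv vs (Phi_quotient (t, 1)) x"
    if "t \<in> T" "t \<noteq> 0" for t x
  proof -
    have "smooth (Phi (0, 1))" "smooth (Phi_quotient (t, 1))"
      using that zero_in_T by (auto intro!: fibre_C_smooth[OF Phi_smooth] fibre_C_smooth[OF smooth_Phi_quotient])
    from iter_deriv_add_scale[OF this assms(2), of t]
    have "iter_deriv vs (Phi (t, 1)) x = iter_deriv vs (Phi (0, 1)) x + t * iter_deriv vs (Phi_quotient (t, 1)) x"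
      by (simp flip: Phi_expansion[OF that(1)])
    then show ?thesis using that(2) by simp
  qed
  then show ?thesis
    using fibre_C_uniform_limit[OF fibre_C_iter_deriv[OF smooth_Phi_quotient assms(2)] compact_T assms(1,3) zero_in_T assms(5)]
    by (simp add: assms(3,4))
qed

end

section \<open>Derivatives in \<theta> of fields on the plane, and joint continuity\<close>

lemma smooth_differentiable: "smooth f \<Longrightarrow> f differentiable at x"
  unfolding smooth_open_def using lists.Nil[of Basis] by (metis iter_deriv.simps(1) UNIV_I)

lemma smooth_iter_deriv_continuous:
  assumes "smooth g" "vs \<in> lists Basis"
  shows "continuous_on S (iter_deriv vs g)"
  using assms
  by (auto simp: smooth_open_def intro!: continuous_at_imp_continuous_on differentiable_imp_continuous_within)

lemma fibre_C_of_derivatives: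
  assumes "\<And>j. continuous_on (S \<times> UNIV) (\<lambda>z. D j (fst z) (snd z))"
    and "\<And>j p x. p \<in> S \<Longrightarrow> (D j p has_real_derivative D (Suc j) p x) (at x)"
  shows "fibre_C k S (D j)"
proof (induction k arbitrary: j)
  case 0
  show ?case using assms(1) by simp
next
  case (Suc k)
  show ?case
    by (rule fibre_C_SucI[OF assms(1,2) Suc])
qed

text \<open>Expressed through \<open>iter_deriv\<close> in the basis direction
  \<open>(0, 1)\<close>, so that the convergence in \<open>has_smooth_derivative\<close> applies to
  it verbatim.\<close>

definition theta_deriv :: "nat \<Rightarrow> (real \<times> real \<Rightarrow> real \<times> real) \<Rightarrow> real \<times> real \<Rightarrow> real \<times> real" where
  "theta_deriv j = iter_deriv (replicate j (0, 1))"

lemma theta_list: "replicate j (0, 1) \<in> lists (Basis :: (real \<times> real) set)"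
  by (induction j) (auto simp: Basis_prod_def)

lemma theta_deriv_0 [simp]: "theta_deriv 0 g = g"
  by (simp add: theta_deriv_def)

lemma theta_deriv_continuous: "smooth g \<Longrightarrow> continuous_on S (theta_deriv j g)"
  unfolding theta_deriv_def by (intro smooth_iter_deriv_continuous theta_list)

lemma theta_deriv_Suc:
  assumes "smooth g"
  shows "((\<lambda>x. snd (theta_deriv j g (s, x))) has_real_derivative snd (theta_deriv (Suc j) g (s, x))) (at x)"
proof -
  define D where "D = frechet_derivative (theta_deriv j g) (at (s, x))"
  have "(theta_deriv j g has_derivative D) (at (s, x))"
    using assms theta_list[of j] unfolding D_def theta_deriv_def smooth_open_def
    by (simp add: frechet_derivative_works)
  moreover have "((\<lambda>x. (s, x)) has_derivative (\<lambda>h. (0, h))) (at x)"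
    by (auto intro!: derivative_eq_intros)
  ultimately have "((\<lambda>x. snd (theta_deriv j g (s, x))) has_derivative (\<lambda>h. snd (D (0, h)))) (at x)"
    using has_derivative_compose[of "\<lambda>x. (s, x)"] by (intro has_derivative_snd) blast
  moreover have "snd (D (0, h)) = snd (theta_deriv (Suc j) g (s, x)) * h" for h
  proof -
    have "linear D"
      unfolding D_def using \<open>(theta_deriv j g has_derivative D) (at (s, x))\<close> D_def has_derivative_linear by blast
    then have "D (h *\<^sub>R (0, 1)) = h *\<^sub>R D (0, 1)" by (rule linear_cmul)
    then show ?thesis
      by (simp add: theta_deriv_def D_def)
  qed
  ultimately show ?thesis
    by (simp add: has_field_derivative_def fun_eq_iff)
qed

lemma fibre_C_snd_smooth:
  fixes g :: "real \<times> real \<Rightarrow> real \<times> real"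
  assumes "smooth g" "continuous_on S h"
  shows "fibre_C k S (\<lambda>p x. snd (g (h p, x)))"
proof -
  have c: "continuous_on (S \<times> UNIV) (\<lambda>z. (h (fst z), snd z))"
    by (intro continuous_on_Pair continuous_on_compose2[OF assms(2)] continuous_intros) auto
  have "fibre_C k S ((\<lambda>j p x. snd (theta_deriv j g (h p, x))) 0)"
  proof (rule fibre_C_of_derivatives)
    show "continuous_on (S \<times> UNIV) (\<lambda>z. snd (theta_deriv j g (h (fst z), snd z)))" for j
      by (intro continuous_on_snd continuous_on_compose2[OF theta_deriv_continuous[OF assms(1), of UNIV] c]) auto
  qed (rule theta_deriv_Suc[OF assms(1)])
  then show ?thesis by simp
qed

text \<open>Points of \<open>T\<close> other than \<open>l\<close> are isolated, so joint continuity is only an issue at \<open>l\<close>.\<close>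

lemma continuous_on_isolated_family:
  fixes F :: "real \<Rightarrow> 'a::heine_borel \<Rightarrow> 'b::metric_space"
  assumes cont: "\<And>t. t \<in> T \<Longrightarrow> continuous_on UNIV (F t)"
    and isol: "\<And>t. t \<in> T \<Longrightarrow> t \<noteq> l \<Longrightarrow> \<not> t islimpt T"
    and unif: "\<And>K. compact K \<Longrightarrow> uniform_limit K F (F l) (at l)"
  shows "continuous_on (T \<times> UNIV) (\<lambda>z. F (fst z) (snd z))"
  unfolding continuous_on_iff
proof (intro ballI allI impI)
  fix z :: "real \<times> 'a" and e :: real assume z: "z \<in> T \<times> UNIV" and e: "e > 0"
  obtain t x where zt: "z = (t, x)" by (cases z)
  have t: "t \<in> T" using z zt by simp
  obtain d where d: "d > 0" "\<And>y. dist y x < d \<Longrightarrow> dist (F t y) (F t x) < e / 2"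
    using cont[OF t] e unfolding continuous_on_iff by (metis UNIV_I half_gt_zero)
  obtain d' where d': "d' > 0"
    "\<And>u y. u \<in> T \<Longrightarrow> dist u t < d' \<Longrightarrow> dist y x < d' \<Longrightarrow> dist (F u y) (F t y) < e / 2"
  proof (cases "t = l")
    case True
    \<comment> \<open>The closed unit ball serves as a compact neighbourhood of \<open>x\<close>;
      this is the source of the bound 1 in \<open>min r 1\<close>.\<close>
    have "\<forall>\<^sub>F u in at l. \<forall>y\<in>cball x 1. dist (F u y) (F l y) < e / 2"
      using e by (intro uniform_limitD[OF unif]) auto
    then obtain r where r: "r > 0" "\<And>u y. u \<noteq> l \<Longrightarrow> dist u l < r \<Longrightarrow> dist x y \<le> 1 \<Longrightarrow>
      dist (F u y) (F l y) < e / 2"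
      unfolding eventually_at by auto
    show thesis
    proof (rule that[of "min r 1"])
      show "0 < min r 1" using r(1) by simp
      fix u y assume "dist u t < min r 1" "dist y x < min r 1"
      then show "dist (F u y) (F t y) < e / 2"
        using r(2)[of u y] True e by (cases "u = l") (auto simp: dist_commute)
    qed
  next
    case False
    then obtain r where r: "r > 0" "\<And>u. u \<in> T \<Longrightarrow> u \<noteq> t \<Longrightarrow> \<not> dist u t < r"
      using isol[OF t] unfolding islimpt_approachable by blast
    show thesis
    proof (rule that[OF r(1)])
      fix u y assume "u \<in> T" "dist u t < r"
      then have "u = t" using r(2) by blast
      then show "dist (F u y) (F t y) < e / 2" using e by simp
    qed
  qed
  show "\<exists>d>0. \<forall>z'\<in>T \<times> UNIV. dist z' z < d \<longrightarrow> dist (F (fst z') (snd z')) (F (fst z) (snd z)) < e"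
  proof (intro exI[of _ "min d d'"] conjI ballI impI)
    fix z' assume z': "z' \<in> T \<times> UNIV" "dist z' z < min d d'"
    have "dist (fst z') t < d'" "dist (snd z') x < d'" "dist (snd z') x < d"
      using dist_fst_le[of z' z] dist_snd_le[of z' z] z'(2) by (auto simp: zt)
    then have "dist (F (fst z') (snd z')) (F t (snd z')) < e / 2" "dist (F t (snd z')) (F t x) < e / 2"
      using d(2) d'(2) z'(1) by auto
    then show "dist (F (fst z') (snd z')) (F (fst z) (snd z)) < e"
      unfolding zt fst_conv snd_conv
      using dist_triangle[of "F (fst z') (snd z')" "F t x" "F t (snd z')"] by linarith
  qed (use d(1) d'(1) in simp)
qed

section \<open>A differentiable curve of periodic fields and its flows\<close>

locale torus_curve =
  fixes G :: "real \<Rightarrow> real \<times> real \<Rightarrow> real \<times> real" and G' :: "real \<times> real \<Rightarrow> real \<times> real" and \<epsilon> :: real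
  assumes eps: "\<epsilon> > 0"
    and smooth_G: "\<And>t. \<bar>t\<bar> < \<epsilon> \<Longrightarrow> smooth (G t)"
    and period_G: "\<And>t s x. \<bar>t\<bar> < \<epsilon> \<Longrightarrow> G t (s + 1, x) = G t (s, x)"
      "\<And>t s x. \<bar>t\<bar> < \<epsilon> \<Longrightarrow> G t (s, x + 1) = G t (s, x)"
    and deriv_G: "has_smooth_derivative G G' 0"
begin

definition b :: "real \<times> real \<Rightarrow> real \<Rightarrow> real" where
  "b p x = snd (G (fst p) (snd p, x))"

text \<open>The value at \<open>t = 0\<close> is the limit supplied by \<open>deriv_G\<close>. With
  it, the order \<open>Suc j\<close> is the \<theta>-derivative of the order \<open>j\<close> for
  every \<open>t\<close> of modulus below \<epsilon>, including 0.\<close>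

definition quotient_deriv :: "nat \<Rightarrow> real \<Rightarrow> real \<times> real \<Rightarrow> real \<times> real" where
  "quotient_deriv j t z = (if t = 0 then theta_deriv j G' z else (theta_deriv j (G t) z - theta_deriv j (G 0) z) /\<^sub>R t)"

definition \<beta> :: "real \<times> real \<Rightarrow> real \<Rightarrow> real" where
  "\<beta> p x = snd (quotient_deriv 0 (fst p) (snd p, x))"

lemma smooth_G': "smooth G'"
  using deriv_G by (simp add: has_smooth_derivative_def)

lemma quotient_deriv_uniform_limit:
  assumes "compact K"
  shows "uniform_limit K (quotient_deriv j) (quotient_deriv j 0) (at 0)"
proof -
  have u: "uniform_limit K (\<lambda>t x. (theta_deriv j (G t) x - theta_deriv j (G 0) x) /\<^sub>R (t - 0))
      (theta_deriv j G') (at 0)"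
    using deriv_G assms theta_list unfolding has_smooth_derivative_def theta_deriv_def by blast
  \<comment> \<open>The filter \<open>at 0\<close> omits the point 0, so the filled-in value does
    not interfere.\<close>
  show ?thesis
  proof (rule uniform_limit_cong[THEN iffD1, OF _ _ u])
    show "\<forall>\<^sub>F t in at 0. \<forall>x\<in>K. (theta_deriv j (G t) x - theta_deriv j (G 0) x) /\<^sub>R (t - 0) = quotient_deriv j t x"
      using eventually_neq_at_within[of "0::real" 0 UNIV] by eventually_elim (simp add: quotient_deriv_def)
  qed (simp add: quotient_deriv_def)
qed

lemma quotient_deriv_continuous:
  assumes "\<bar>t\<bar> < \<epsilon>"
  shows "continuous_on UNIV (quotient_deriv j t)"
proof -
  have "continuous_on UNIV (\<lambda>z. (theta_deriv j (G t) z - theta_deriv j (G 0) z) /\<^sub>R t)"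
    using assms eps by (intro continuous_intros theta_deriv_continuous smooth_G) auto
  then show ?thesis
    using theta_deriv_continuous[OF smooth_G', of UNIV j] by (cases "t = 0") (simp_all add: quotient_deriv_def[abs_def])
qed

text \<open>Joint continuity of every \<open>quotient_deriv j\<close> comes from the isolated points
  of \<open>T\<close> and from uniform convergence at 0; these functions then form a chain of
  successive \<theta>-derivatives starting at \<beta>.\<close>

lemma smooth_beta:
  assumes "T \<subseteq> {-\<epsilon><..<\<epsilon>}" "\<And>t. t \<in> T \<Longrightarrow> t \<noteq> 0 \<Longrightarrow> \<not> t islimpt T"
  shows "fibre_C k (T \<times> UNIV) \<beta>"
proof -
  have T: "\<bar>t\<bar> < \<epsilon>" if "t \<in> T" for t using that assms(1) by (auto simp: abs_less_iff subset_iff)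
  have "fibre_C k (T \<times> UNIV) ((\<lambda>j p x. snd (quotient_deriv j (fst p) (snd p, x))) 0)"
  proof (rule fibre_C_of_derivatives)
    fix j
    have c: "continuous_on (T \<times> UNIV) (\<lambda>z. quotient_deriv j (fst z) (snd z))"
      by (intro continuous_on_isolated_family[where l = 0] quotient_deriv_continuous T assms(2) quotient_deriv_uniform_limit)
    have "continuous_on ((T \<times> UNIV) \<times> UNIV) (\<lambda>z. (fst (fst z), (snd (fst z), snd z)))"
      by (intro continuous_intros)
    from continuous_on_compose2[OF c this]
    have "continuous_on ((T \<times> UNIV) \<times> UNIV) (\<lambda>z. quotient_deriv j (fst (fst z)) (snd (fst z), snd z))"
      by (simp add: image_subset_iff mem_Times_iff)
    then show "continuous_on ((T \<times> UNIV) \<times> UNIV) (\<lambda>z. snd (quotient_deriv j (fst (fst z)) (snd (fst z), snd z)))"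
      by (rule continuous_on_snd)
  next
    fix j p and x :: real assume p: "p \<in> T \<times> (UNIV :: real set)"
    obtain t s where ts: "p = (t, s)" "\<bar>t\<bar> < \<epsilon>" using p T by auto
    have "((\<lambda>x. (snd (theta_deriv j (G t) (s, x)) - snd (theta_deriv j (G 0) (s, x))) / t)
      has_real_derivative
      (snd (theta_deriv (Suc j) (G t) (s, x)) - snd (theta_deriv (Suc j) (G 0) (s, x))) / t) (at x)"
      using ts(2) eps by (intro DERIV_cdivide DERIV_diff theta_deriv_Suc smooth_G) auto
    then show "((\<lambda>x. snd (quotient_deriv j (fst p) (snd p, x))) has_real_derivative
       snd (quotient_deriv (Suc j) (fst p) (snd p, x))) (at x)"
      using theta_deriv_Suc[OF smooth_G']
      by (cases "t = 0") (simp_all add: quotient_deriv_def ts(1) divide_inverse mult.commute)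
  qed
  then show ?thesis by (simp add: \<beta>_def[abs_def])
qed

lemma b_expansion: "b (t, s) x = b (0, s) x + t * \<beta> (t, s) x"
  by (cases "t = 0") (simp_all add: b_def \<beta>_def quotient_deriv_def field_simps)

lemma differentiable_family:
  assumes "compact T" "T \<subseteq> {-\<epsilon><..<\<epsilon>}" "\<And>t. t \<in> T \<Longrightarrow> t \<noteq> 0 \<Longrightarrow> \<not> t islimpt T" "0 \<in> T"
  shows "differentiable_family T b \<beta>"
proof
  have T: "\<bar>t\<bar> < \<epsilon>" if "t \<in> T" for t using that assms(2) by (auto simp: abs_less_iff subset_iff)
  show "fibre_C k (T \<times> UNIV) \<beta>" for k
    by (rule smooth_beta[OF assms(2,3)])
  \<comment> \<open>Regularity of \<open>b\<close> in the parameter is obtained through its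
    expansion at 0, since \<beta> carries all the information on the dependence on
    \<open>t\<close>.\<close>
  have "fibre_C k (T \<times> UNIV) (\<lambda>p x. snd (G 0 (snd p, x)) + fst p * \<beta> p x)" for k
    using eps by (intro fibre_C_add fibre_C_mult fibre_C_snd_smooth smooth_G fibre_C_param
      smooth_beta assms continuous_intros) auto
  moreover have "(\<lambda>p x. snd (G 0 (snd p, x)) + fst p * \<beta> p x) = b"
  proof (intro ext)
    show "snd (G 0 (snd p, x)) + fst p * \<beta> p x = b p x" for p x
      using b_expansion[of "fst p" "snd p" x] b_def[of "(0, snd p)" x] by simp
  qed
  ultimately show "fibre_C k (T \<times> UNIV) b" for k
    by simp
  show "b (t, s + 1) x = b (t, s) x" "b (t, s) (x + 1) = b (t, s) x" if "t \<in> T" for t s x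
    using period_G[OF T[OF that]] by (auto simp: b_def)
  show "b (t, s) x = b (0, s) x + t * \<beta> (t, s) x" for t s x
    by (rule b_expansion)
qed (fact assms)+

text \<open>Provides the flow and the diffeomorphism property for each individual \<open>t\<close>,
  with only continuity in time and space at stake.\<close>

lemma periodic_family_single:
  assumes "\<bar>t\<bar> < \<epsilon>"
  shows "periodic_family {t} b"
proof
  have "fibre_C k ({t} \<times> UNIV) (\<lambda>p x. snd (G t (snd p, x)))" for k
    by (intro fibre_C_snd_smooth smooth_G assms continuous_intros)
  moreover have "fibre_C k ({t} \<times> UNIV) b = fibre_C k ({t} \<times> UNIV) (\<lambda>p x. snd (G t (snd p, x)))" for k
    by (rule fibre_C_cong) (auto simp: b_def)
  ultimately show "fibre_C k ({t} \<times> UNIV) b" for k by simp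
  show "b (u, s + 1) x = b (u, s) x" "b (u, s) (x + 1) = b (u, s) x" if "u \<in> {t}" for u s x
    using period_G[of t] assms that by (auto simp: b_def)
qed simp

lemma poincare_derivative:
  assumes \<Psi>: "\<And>t. \<bar>t\<bar> < \<epsilon> \<Longrightarrow> is_flow (\<lambda>z. snd (G t z)) (\<Psi> t)"
  shows "Diff_circle_has_derivative_at_0 \<epsilon> (\<lambda>t. \<Psi> t 1)
    (\<lambda>\<theta>. integral {0..1} (\<lambda>\<phi>.
       exp (integral {\<phi>..1} (\<lambda>r. deriv (\<lambda>y. snd (G 0 (r, y))) (\<Psi> 0 r \<theta>)))
       * snd (G' (\<phi>, \<Psi> 0 \<phi> \<theta>))))"
    (is "Diff_circle_has_derivative_at_0 _ _ ?f'")
proof -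
  have b: "snd (G t z) = b (t, fst z) (snd z)" for t z
    by (simp add: b_def)
  \<comment> \<open>\<open>Phi\<close> is chosen separately for each \<open>T\<close>; uniqueness of
    the flow identifies all these choices with \<Psi>.\<close>
  have Phi: "\<Psi> t s = periodic_family.Phi T b (t, s)"
    if "periodic_family T b" "t \<in> T" "\<bar>t\<bar> < \<epsilon>" for T t s
    using \<Psi>[OF that(3)] periodic_family.is_flow_iff[OF that(1,2), of "\<Psi> t"] by (simp add: b)
  have diffeo: "circle_diffeo (\<Psi> t 1)" if "\<bar>t\<bar> < \<epsilon>" for t
    using periodic_family.circle_diffeo_Phi[OF periodic_family_single[OF that], of t]
      Phi[OF periodic_family_single[OF that] _ that] by simp
  have f': "differentiable_family.Phi_quotient T b \<beta> (0, 1) = ?f'" if "differentiable_family T b \<beta>" for T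
  proof -
    interpret differentiable_family T b \<beta> by (rule that)
    have "\<Psi> 0 s = Phi (0, s)" for s
      using Phi[OF periodic_family_axioms zero_in_T] eps by simp
    moreover have "b (0, r) = (\<lambda>y. snd (G 0 (r, y)))" for r
      by (simp add: b_def[abs_def])
    moreover have "\<beta> (0, s) x = snd (G' (s, x))" for s x
      by (simp add: \<beta>_def quotient_deriv_def)
    ultimately show ?thesis
      by (intro ext) (simp add: Phi_quotient_at_zero)
  qed
  \<comment> \<open>The candidate derivative does not depend on \<open>T\<close>, so its smoothness
    can be read off from the smallest family \<open>{0}\<close>.\<close>
  have fam0: "differentiable_family {0} b \<beta>"
    using eps by (intro differentiable_family) (auto simp: islimpt_finite)
  have "smooth (differentiable_family.Phi_quotient {0} b \<beta> (0, 1))"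
    using fibre_C_smooth[OF differentiable_family.smooth_Phi_quotient[OF fam0], of "(0, 1)"] by simp
  then have smooth_f': "smooth ?f'" unfolding f'[OF fam0] .
  have \<Psi>_shift: "\<Psi> 0 s (x + 1) = \<Psi> 0 s x + 1" for s x
    using periodic_family.Phi_shift[OF periodic_family_single, of 0 0 s x] eps
      Phi[OF periodic_family_single, of 0 0] by simp
  have "snd (G' (s, x + 1)) = snd (G' (s, x))" for s x
  proof -
    \<comment> \<open>Periodicity of the \<theta>-component of the derivative field is inherited
      from the difference quotients through their pointwise limit.\<close>
    have "((\<lambda>t. quotient_deriv 0 t (s, y)) \<longlongrightarrow> G' (s, y)) (at 0)" for y
      using tendsto_uniform_limitI[OF quotient_deriv_uniform_limit[of "{(s, y)}" 0]] by (simp add: quotient_deriv_def)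
    note lim = this[of "x + 1"] this[of x]
    have "\<forall>\<^sub>F t in at 0. \<bar>t\<bar> < \<epsilon>"
      using eps eventually_at[of "\<lambda>t::real. \<bar>t\<bar> < \<epsilon>" 0 UNIV] by (auto simp: dist_real_def)
    then have "\<forall>\<^sub>F t in at 0. quotient_deriv 0 t (s, x + 1) = quotient_deriv 0 t (s, x)"
      using eventually_neq_at_within[of "0::real" 0 UNIV]
      by eventually_elim (use eps in \<open>simp add: quotient_deriv_def period_G\<close>)
    then have "((\<lambda>t. quotient_deriv 0 t (s, x + 1)) \<longlongrightarrow> G' (s, x)) (at 0)"
      using lim(2) by (simp add: tendsto_cong)
    then show ?thesis
      using tendsto_unique[OF _ lim(1)] by simp
  qed
  note G'_shift = this
  have deriv_shift: "deriv (\<lambda>y. snd (G 0 (r, y))) (x + 1) = deriv (\<lambda>y. snd (G 0 (r, y))) x" for r x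
  proof (rule deriv_periodic)
    show "snd (G 0 (r, y + 1)) = snd (G 0 (r, y))" for y
      using period_G eps by simp
    show "((\<lambda>y. snd (G 0 (r, y))) has_real_derivative deriv (\<lambda>y. snd (G 0 (r, y))) y) (at y)" for y
      using theta_deriv_Suc[OF smooth_G[of 0], of 0 r y] eps by (simp add: DERIV_imp_deriv)
  qed
  have unif: "uniform_limit K
          (\<lambda>t x. (iter_deriv vs (\<Psi> t 1) x - iter_deriv vs (\<Psi> 0 1) x) /\<^sub>R (t - 0))
          (iter_deriv vs ?f') (at 0)" if vs: "vs \<in> lists Basis" and K: "compact K" for vs K
  proof (rule uniform_limitI)
    fix e :: real assume "e > 0"
    have "\<forall>\<^sub>F t in at 0 within {-\<epsilon><..<\<epsilon>}. \<forall>x\<in>K.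
      dist ((iter_deriv vs (\<Psi> t 1) x - iter_deriv vs (\<Psi> 0 1) x) /\<^sub>R (t - 0)) (iter_deriv vs ?f' x) < e"
    \<comment> \<open>Testing the limit on sequences is what permits a separate compact set
      \<open>T\<close> for each of them.\<close>
    proof (intro sequentially_imp_eventually_within allI impI)
      fix \<tau> :: "nat \<Rightarrow> real"
      assume "(\<forall>n. \<tau> n \<in> {-\<epsilon><..<\<epsilon>} \<and> \<tau> n \<noteq> 0) \<and> \<tau> \<longlonglongrightarrow> 0"
      then have \<tau>: "\<And>n. \<bar>\<tau> n\<bar> < \<epsilon>" "\<And>n. \<tau> n \<noteq> 0" "\<tau> \<longlonglongrightarrow> 0"
        by (auto simp: abs_less_iff minus_less_iff[of _ \<epsilon>])
      define T where "T = insert 0 (range \<tau>)"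
      have T: "\<tau> n \<in> T" for n by (simp add: T_def)
      have fam: "differentiable_family T b \<beta>"
      proof (rule differentiable_family)
        show "compact T" unfolding T_def by (rule compact_sequence_with_limit[OF \<tau>(3)])
        show "T \<subseteq> {-\<epsilon><..<\<epsilon>}" using \<tau>(1) eps by (auto simp: T_def abs_less_iff minus_less_iff[of _ \<epsilon>])
        \<comment> \<open>A convergent sequence has no limit point other than its limit, and adding
          the point 0 creates none.\<close>
        show "\<not> t islimpt T" if "t \<noteq> 0" for t
          using sequence_unique_limpt[OF \<tau>(3)] that by (auto simp: T_def islimpt_insert)
      qed (simp add: T_def)
      interpret differentiable_family T b \<beta> by (rule fam)
      have "\<Psi> (\<tau> n) 1 = Phi (\<tau> n, 1)" "\<Psi> 0 1 = Phi (0, 1)" for n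
        using Phi[OF periodic_family_axioms] T zero_in_T \<tau>(1) eps by auto
      then have "uniform_limit K
          (\<lambda>n x. (iter_deriv vs (\<Psi> (\<tau> n) 1) x - iter_deriv vs (\<Psi> 0 1) x) /\<^sub>R \<tau> n)
          (iter_deriv vs ?f') sequentially"
        using Phi_quotient_uniform_limit[OF K vs T \<tau>(2,3)] by (simp add: f'[OF fam])
      from uniform_limitD[OF this \<open>e > 0\<close>]
      show "\<forall>\<^sub>F n in sequentially. \<forall>x\<in>K.
        dist ((iter_deriv vs (\<Psi> (\<tau> n) 1) x - iter_deriv vs (\<Psi> 0 1) x) /\<^sub>R (\<tau> n - 0)) (iter_deriv vs ?f' x) < e"
        by simp
    qed
    then show "\<forall>\<^sub>F t in at 0. \<forall>x\<in>K.
      dist ((iter_deriv vs (\<Psi> t 1) x - iter_deriv vs (\<Psi> 0 1) x) /\<^sub>R (t - 0)) (iter_deriv vs ?f' x) < e"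
      using eps by (subst (asm) at_within_open) auto
  qed
  have "\<forall>\<^sub>F t in nhds 0. smooth (\<Psi> t 1)"
  proof -
    have "\<forall>\<^sub>F t in nhds 0. t \<in> {-\<epsilon><..<\<epsilon>}"
      using eps by (intro eventually_nhds_in_open) auto
    then show ?thesis
      by eventually_elim (use diffeo in \<open>auto simp: abs_less_iff circle_diffeo_def diffeomorphism_def\<close>)
  qed
  then have "has_smooth_derivative (\<lambda>t. \<Psi> t 1) ?f' 0"
    unfolding has_smooth_derivative_def using smooth_f' unif by blast
  moreover have "?f' (\<theta> + 1) = ?f' \<theta>" for \<theta>
    by (simp add: \<Psi>_shift deriv_shift G'_shift)
  ultimately show ?thesis
    unfolding Diff_circle_has_derivative_at_0_def using diffeo by blast
qed

end

section \<open>From fields on the moving surfaces to fields on the plane\<close>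

text \<open>Both the point \<open>E p\<close> and the differential of \<open>E\<close> at
  \<open>p\<close> are unchanged by integer translations, and \<open>components\<close> depends on
  \<open>p\<close> only through these two.\<close>

lemma components_shift:
  assumes "torus_embedding E" "fst k \<in> \<int>" "snd k \<in> \<int>"
  shows "components E Y (p + k) = components E Y p"
proof -
  have "E p = E q \<longleftrightarrow> fst p - fst q \<in> \<int> \<and> snd p - snd q \<in> \<int>" for p q
    using assms(1) unfolding torus_embedding_def by blast
  from this[of "_ + k"] have E: "E (q + k) = E q" for q
    using assms(2,3) by simp
  have "E differentiable at (p + k)"
    using assms(1) by (auto simp: torus_embedding_def intro: smooth_differentiable)
  then have "(E has_derivative frechet_derivative E (at (p + k))) (at (p + k))"
    by (simp add: frechet_derivative_works)
  moreover have "((\<lambda>q. q + k) has_derivative (\<lambda>h. h)) (at p)"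
    by (auto intro!: derivative_eq_intros)
  ultimately have "((\<lambda>q. E (q + k)) has_derivative frechet_derivative E (at (p + k))) (at p)"
    using has_derivative_compose[of "\<lambda>q. q + k"] by blast
  then have "frechet_derivative E (at (p + k)) = frechet_derivative E (at p)"
    using frechet_derivative_at E by simp
  then show ?thesis
    by (simp add: components_def E)
qed

text \<open>By the chain rule the differential of \<open>P \<circ> E\<close> is that of
  \<open>P\<close> after that of \<open>E\<close>, and the differential of \<open>P\<close> undoes
  that of its inverse. A field on the moved surface therefore has the same coordinates as its
  pullback to the fixed one.\<close>

lemma components_pushforward:
  assumes E: "torus_embedding E" and P: "diffeomorphism P" and PE: "torus_embedding (P \<circ> E)"
    and range: "pushforward (inv_into UNIV P) X (E p) \<in> range (frechet_derivative E (at p))"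
  shows "components (P \<circ> E) X p = components E (pushforward (inv_into UNIV P) X) p"
proof -
  define R where "R = inv_into UNIV P"
  define c where "c = components E (pushforward R X) p"
  have bij: "bij P" and smooth: "smooth P" "smooth R" "smooth E"
    using P E by (auto simp: diffeomorphism_def torus_embedding_def R_def)
  have PR: "P (R y) = y" and RP: "R (P y) = y" for y
    using bij by (simp_all add: R_def bij_is_surj surj_f_inv_f bij_is_inj)
  have "inv_into UNIV R = P"
    unfolding R_def using bij by (rule inv_inv_eq)
  then have pf: "pushforward R X y = frechet_derivative R (at (P y)) (X (P y))" for y
    by (simp add: pushforward_def)
  have inj: "inj (frechet_derivative E (at p))" "inj (frechet_derivative (P \<circ> E) (at p))"
    using E PE unfolding torus_embedding_def by blast+
  \<comment> \<open>Tangency supplies a coordinate vector \<open>d\<close>; injectivity of the two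
    differentials makes it the value of both definite descriptions.\<close>
  obtain d where d: "frechet_derivative E (at p) d = pushforward R X (E p)"
    using range by (auto simp: R_def)
  then have "c = d"
    unfolding c_def components_def by (intro the_equality d injD[OF inj(1)]) (simp add: d)
  have dP: "(P has_derivative frechet_derivative P (at y)) (at y)"
    and dR: "(R has_derivative frechet_derivative R (at y)) (at y)" for y
    using smooth by (simp_all add: smooth_differentiable flip: frechet_derivative_works)
  have dE: "(E has_derivative frechet_derivative E (at p)) (at p)"
    using smooth by (simp add: smooth_differentiable flip: frechet_derivative_works)
  have "((\<lambda>y. P (R y)) has_derivative (\<lambda>h. frechet_derivative P (at (R (P (E p)))) 
      (frechet_derivative R (at (P (E p))) h))) (at (P (E p)))"
    by (rule has_derivative_compose[OF dR dP])
  then have "((\<lambda>y. y) has_derivative (\<lambda>h. frechet_derivative P (at (E p))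
      (frechet_derivative R (at (P (E p))) h))) (at (P (E p)))"
    by (simp add: PR RP)
  then have id: "(\<lambda>h. frechet_derivative P (at (E p)) (frechet_derivative R (at (P (E p))) h)) = (\<lambda>h. h)"
    using has_derivative_unique[OF _ has_derivative_ident] by blast
  have "((P \<circ> E) has_derivative (\<lambda>h. frechet_derivative P (at (E p)) (frechet_derivative E (at p) h))) (at p)"
    using has_derivative_compose[OF dE dP] by (simp add: o_def)
  from frechet_derivative_at[OF this, symmetric]
  have "frechet_derivative (P \<circ> E) (at p) d = X ((P \<circ> E) p)"
    using fun_cong[OF id, of "X (P (E p))"] by (simp add: d pf)
  then have "components (P \<circ> E) X p = d"
    unfolding components_def by (intro the_equality injD[OF inj(2)]) simp_all
  then show ?thesis
    using \<open>c = d\<close> by (simp add: c_def R_def)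
qed

theorem proposition2p11:
  fixes E :: "real \<times> real \<Rightarrow> real^3"
    and P :: "real \<Rightarrow> real^3 \<Rightarrow> real^3"
    and V X' :: "real^3 \<Rightarrow> real^3"
    and \<epsilon> :: real
  assumes "admissible E"
    and "\<epsilon> > 0"
    and "\<And>t. \<bar>t\<bar> < \<epsilon> \<Longrightarrow> diffeomorphism (P t)"
    and "\<And>t. \<bar>t\<bar> < \<epsilon> \<Longrightarrow> \<exists>W. has_smooth_derivative P W t"
    and "P 0 = id"
    and "has_smooth_derivative P V 0"
    and "\<And>t. \<bar>t\<bar> < \<epsilon> \<Longrightarrow> admissible (P t \<circ> E)"
    and "Vec_has_derivative_at_0 E \<epsilon> (\<lambda>t. pushforward (inv_into UNIV (P t)) (X_field (P t \<circ> E))) X'"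
  shows "Diff_circle_has_derivative_at_0 \<epsilon> (\<lambda>t. Poincare_map (P t \<circ> E))
    (\<lambda>\<theta>. integral {0..1} (\<lambda>\<phi>.
       exp (integral {\<phi>..1} (\<lambda>\<phi>'.
              deriv (\<lambda>y. theta_component E (X_field E) (\<phi>', y)) (flow E \<phi>' \<theta>)))
       * theta_component E X' (\<phi>, flow E \<phi> \<theta>)))"
proof -
  define Y where "Y t = pushforward (inv_into UNIV (P t)) (X_field (P t \<circ> E))" for t
  define G where "G t = components E (Y t)" for t
  have E: "torus_embedding E"
    using assms(1) by (simp add: admissible_def)
  have Y: "Y t \<in> Vec E" if "\<bar>t\<bar> < \<epsilon>" for t
    using assms(8) that by (simp add: Vec_has_derivative_at_0_def Y_def)
  interpret torus_curve G "components E X'" \<epsilon>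
  proof
    show "\<epsilon> > 0" by fact
    show "smooth (G t)" if "\<bar>t\<bar> < \<epsilon>" for t
      using Y[OF that] by (simp add: Vec_def G_def)
    show "G t (s + 1, x) = G t (s, x)" "G t (s, x + 1) = G t (s, x)" for t s x
      using components_shift[OF E, of "(1, 0)" "Y t" "(s, x)"]
        components_shift[OF E, of "(0, 1)" "Y t" "(s, x)"] by (simp_all add: G_def)
    show "has_smooth_derivative G (components E X') 0"
      using assms(8) by (simp add: Vec_has_derivative_at_0_def Y_def[abs_def] G_def[abs_def])
  qed
  \<comment> \<open>The curve \<open>G\<close>, differentiable by hypothesis as the coordinates of
    the pullbacks, also gives the coordinates of \<open>X_field (P t \<circ> E)\<close> on the moved
    surface, and these define the flow of \<open>P t \<circ> E\<close>.\<close>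
  have G: "components (P t \<circ> E) (X_field (P t \<circ> E)) = G t" if "\<bar>t\<bar> < \<epsilon>" for t
  proof
    fix p
    have "Y t (E p) \<in> range (frechet_derivative E (at p))"
      using Y[OF that] unfolding Vec_def by blast
    moreover have "torus_embedding (P t \<circ> E)"
      using assms(7)[OF that] by (simp add: admissible_def)
    ultimately show "components (P t \<circ> E) (X_field (P t \<circ> E)) p = G t p"
      unfolding Y_def G_def using components_pushforward[OF E assms(3)[OF that]] by blast
  qed
  have flow: "is_flow (\<lambda>z. snd (G t z)) (flow (P t \<circ> E))" if t: "\<bar>t\<bar> < \<epsilon>" for t
  proof -
    interpret periodic_family "{t}" b
      by (rule periodic_family_single[OF t])
    have iff: "is_flow (\<lambda>z. snd (G t z)) \<Psi> \<longleftrightarrow> \<Psi> = (\<lambda>s. Phi (t, s))" for \<Psi>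
      using is_flow_iff[of t \<Psi>] by (simp add: b_def)
    have "flow (P t \<circ> E) = (\<lambda>s. Phi (t, s))"
      unfolding flow_def G[OF t] iff by simp
    then show ?thesis using iff by simp
  qed
  \<comment> \<open>At \<open>t = 0\<close> this turns the field \<open>G 0\<close> and the flow of
    \<open>P 0 \<circ> E\<close> into the unperturbed data of the stated formula.\<close>
  have "P 0 \<circ> E = E" by (simp add: assms(5))
  then show ?thesis
    using poincare_derivative[OF flow] G[of 0] assms(2) by (simp add: Poincare_map_def)
qed

end
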